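(* There exist absolute constants $c, C>0$ such that for all integers $D\ge 1$ and $n>(2D)^{100D}$, \[\eta(3n)\ \ge\ c\, D^{-C}\,(3/4)^{D/2}\,n^{-2/D}.\] Moreover (optimizing $D$), as $n\to\infty$, \[\eta(n)\ \gg\ 2^{-\left(2\sqrt{\log_2(4/3)}+o(1)\right)\sqrt{\log_2 n}},\] i.e. there exist an absolute constant $c'>0$ and a function $\theta(n)\to 0$ as $n\to\infty$ such that $\eta(n)\ge c'\,2^{-(2\sqrt{\log_2(4/3)}+\theta(n))\sqrt{\log_2 n}}$ for all sufficiently large $n$.
   Context: For an integer $n\ge 1$, $\eta(n)$ denotes the maximum of $e(G)/n^2$ over all $n$-vertex (simple) graphs $G$ in which every edge belongs to exactly one triangle, where $e(G)$ is the number of edges of $G$. *)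

theory Defs
  imports Complex_Main
begin

definition simple_graph :: "'a set \<Rightarrow> 'a set set \<Rightarrow> bool" where
  "simple_graph V E \<longleftrightarrow> finite V \<and> (\<forall>e\<in>E. e \<subseteq> V \<and> card e = 2)"

definition triangle :: "'a set set \<Rightarrow> 'a set \<Rightarrow> bool" where
  "triangle E T \<longleftrightarrow> card T = 3 \<and> (\<forall>x\<in>T. \<forall>y\<in>T. x \<noteq> y \<longrightarrow> {x, y} \<in> E)"

definition edges_in_unique_triangle :: "'a set set \<Rightarrow> bool" where
  "edges_in_unique_triangle E \<longleftrightarrow> (\<forall>e\<in>E. \<exists>!T. triangle E T \<and> e \<subseteq> T)"

text \<open>Vertices are taken to be natural numbers; every finite graph is isomorphic to such a graph.\<close>

definition edge_densities :: "nat \<Rightarrow> real set" where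
  "edge_densities n =
     {real (card E) / (real n)^2 | (V :: nat set) E.
        simple_graph V E \<and> card V = n \<and> edges_in_unique_triangle E}"

definition eta :: "nat \<Rightarrow> real" where
  "eta n = Max (edge_densities n)"

text \<open>The maximum is attained: the set of densities is finite and nonempty.\<close>

lemma finite_edge_densities: "finite (edge_densities n)"
proof (rule finite_subset)
  show "edge_densities n \<subseteq> (\<lambda>k. real k / (real n)^2) ` {..2 ^ n}"
  proof
    fix r assume "r \<in> edge_densities n"
    then obtain V :: "nat set" and E where *: "r = real (card E) / (real n)^2"
      "simple_graph V E" "card V = n"
      unfolding edge_densities_def by blast
    then have "finite V" "E \<subseteq> Pow V" by (auto simp: simple_graph_def)
    then have "card E \<le> card (Pow V)" by (intro card_mono) auto
    then have "card E \<le> 2 ^ n" using \<open>finite V\<close> * by (simp add: card_Pow)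
    then show "r \<in> (\<lambda>k. real k / (real n)^2) ` {..2 ^ n}" using * by auto
  qed
qed simp

lemma edge_densities_nonempty: "edge_densities n \<noteq> {}"
proof -
  have "simple_graph {..<n} {}" "card {..<n} = n" "edges_in_unique_triangle ({} :: nat set set)"
    by (auto simp: simple_graph_def edges_in_unique_triangle_def)
  then show ?thesis unfolding edge_densities_def by blast
qed

end

theory Submission
  imports Defs "HOL-Analysis.Analysis" "HOL-Real_Asymp.Real_Asymp"
begin

text \<open>
  Let \<open>B\<close> be the set of lattice points of norm at most \<open>sqrt R\<close> in \<open>\<int>\<^sup>D\<close>. Take three copies of \<open>B\<close> as
  the parts of a tripartite graph and make \<open>(x, y, x + y)\<close> a triangle whenever all three points
  lie in \<open>B\<close> and \<open>|x - y|\<^sup>2 = r\<close>. Three edges that form a triangle \<open>x, y, z\<close> of the graph come from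
  the triples \<open>(x, y, x + y)\<close>, \<open>(x, z - x, z)\<close> and \<open>(z - y, y, z)\<close>. With \<open>d = z - x - y\<close>
  the vectors \<open>x - y\<close>, \<open>x - y - d\<close>, \<open>x - y + d\<close> all have squared norm \<open>r\<close>, so \<open>d = 0\<close> by the
  parallelogram law: every edge lies in exactly one triangle (\<open>pseudo_triangle_trivial\<close>,
  \<open>eta_ge_of_triples\<close>). Choosing the most popular \<open>r\<close> costs a factor of order
  \<open>R\<close>, that is \<open>D\<^sup>O\<^sup>(\<^sup>1\<^sup>) n\<^sup>2\<^sup>/\<^sup>D\<close> (\<open>eta_ge_of_ball\<close>).

  It remains to see that, when \<open>B\<close> has about \<open>n\<close> points, at least \<open>D\<^sup>-\<^sup>O\<^sup>(\<^sup>1\<^sup>) (3/4)\<^sup>D\<^sup>/\<^sup>2 n\<^sup>2\<close> of the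
  pairs \<open>(x, y)\<close> in \<open>B\<close> have \<open>x + y\<close> in \<open>B\<close>; geometrically, two vectors on a sphere whose sum is on the
  sphere make an angle of 120 degrees, and \<open>sin 120 = sqrt (3/4)\<close>. This is proved by
  comparing Gaussian sums. The sum \<open>g\<close> of \<open>exp (- (u\<^sup>2 + v\<^sup>2 + (u + v)\<^sup>2) / W)\<close> over integers \<open>u, v\<close>
  is close to \<open>sqrt (3/4) h\<^sup>2\<close>, where \<open>h\<close> is the one-dimensional sum of
  \<open>exp (- 3 u\<^sup>2 / (2 W))\<close>. By pigeonhole over
  \<open>D\<^sup>O\<^sup>(\<^sup>1\<^sup>)\<close> cells for the three squared norms, some cell \<open>(i, j, k)\<close> contains at least
  \<open>D\<^sup>-\<^sup>O\<^sup>(\<^sup>1\<^sup>) exp (i + j + k) g\<^sup>m\<close> triples in dimension \<open>m\<close> (\<open>card_triples_ge_gauss\<close>). The three norms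
  need not agree, but concatenating three triples whose entries are rotated cyclically makes
  them agree in dimension \<open>3 m\<close> (\<open>card_triples_threefold\<close>); at most two coordinates remain, and
  they cost a constant. On the other hand the ball of squared radius about \<open>W (i + j + k)\<close> has at
  most about \<open>exp (3 (i + j + k) / 2) h\<^sup>D\<close> points (\<open>card_lattice_ball_le\<close>), so the exponentials cancel
  in the quotient (\<open>many_triples\<close>).

  The configuration so obtained has a size depending on \<open>D\<close> only. Dilating it by an integer, with
  each lattice point replaced by a cube of lattice points, adjusts the size of the ball to a given
  \<open>n\<close> (\<open>card_triples_dilate\<close>, \<open>exists_dilation\<close>). The asymptotic statement is the case
  \<open>D \<approx> 2 sqrt (log 2 n / log 2 (4/3))\<close>.
\<close>

section \<open>From systems of triples to graphs\<close>
lemma eta_ge: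
  fixes V :: "nat set"
  assumes "simple_graph V E" "card V = n" "edges_in_unique_triangle E"
  shows "eta n \<ge> real (card E) / (real n)\<^sup>2"
  unfolding eta_def
  using assms by (intro Max_ge[OF finite_edge_densities]) (auto simp: edge_densities_def)

text \<open>Isolated vertices can be added, so the largest number of edges is monotone.\<close>

lemma eta_mono:
  assumes "M \<le> N"
  shows "eta N * (real N)\<^sup>2 \<ge> eta M * (real M)\<^sup>2"
proof (cases "M = 0")
  case True
  have "simple_graph {..<N} {}" "card {..<N} = N" "edges_in_unique_triangle ({} :: nat set set)"
    by (auto simp: simple_graph_def edges_in_unique_triangle_def)
  from eta_ge[OF this] True show ?thesis by simp
next
  case False
  have "eta M \<in> edge_densities M"
    unfolding eta_def by (rule Max_in[OF finite_edge_densities edge_densities_nonempty])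
  then obtain V :: "nat set" and E where VE: "eta M = real (card E) / (real M)\<^sup>2"
      "simple_graph V E" "card V = M" "edges_in_unique_triangle E"
    by (auto simp: edge_densities_def)
  have "finite V" using VE(2) by (simp add: simple_graph_def)
  have "infinite (UNIV - V)" using \<open>finite V\<close> by simp
  then obtain F where F: "finite F" "card F = N - M" "F \<subseteq> UNIV - V"
    using infinite_arbitrarily_large by blast
  have "simple_graph (V \<union> F) E" using VE(2) F(1) by (auto simp: simple_graph_def)
  moreover have "card (V \<union> F) = N"
    using F VE(3) \<open>finite V\<close> assms by (subst card_Un_disjoint) auto
  ultimately have "eta N \<ge> real (card E) / (real N)\<^sup>2" using VE(4) by (rule eta_ge)
  then show ?thesis using VE(1) False assms by (simp add: field_simps)
qed

text \<open>
  The tripartite graph of a system \<open>T\<close> of triples of indices below \<open>n\<close>: the three parts are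
  \<open>{..<n}\<close>, \<open>{n..<2 * n}\<close> and \<open>{2 * n..<3 * n}\<close>, and each triple contributes the edges of a triangle.
\<close>

definition tripartite_edges :: "nat \<Rightarrow> (nat \<times> nat \<times> nat) set \<Rightarrow> nat set set" where
  "tripartite_edges n T =
     (\<lambda>(x, y, z). {x, n + y}) ` T \<union> (\<lambda>(x, y, z). {n + y, 2 * n + z}) ` T
       \<union> (\<lambda>(x, y, z). {x, 2 * n + z}) ` T"

lemma tripartite_edges_cases:
  assumes "{p, q} \<in> tripartite_edges n T"
    and "T \<subseteq> {..<n} \<times> {..<n} \<times> {..<n}" "p < q"
  shows "(p < n \<and> n \<le> q \<and> q < 2 * n \<and> (\<exists>z. (p, q - n, z) \<in> T)) \<or>
         (n \<le> p \<and> p < 2 * n \<and> 2 * n \<le> q \<and> q < 3 * n \<and> (\<exists>x. (x, p - n, q - 2 * n) \<in> T)) \<or>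
         (p < n \<and> 2 * n \<le> q \<and> q < 3 * n \<and> (\<exists>y. (p, y, q - 2 * n) \<in> T))"
proof -
  have *: "{p, q} = {a, b} \<longleftrightarrow> p = a \<and> q = b" if "a < b" for a b :: nat
    using that assms(3) by (auto simp: doubleton_eq_iff)
  from assms(1) obtain x y z where xyz: "(x, y, z) \<in> T"
    and e: "{p, q} = {x, n + y} \<or> {p, q} = {n + y, 2 * n + z} \<or> {p, q} = {x, 2 * n + z}"
    unfolding tripartite_edges_def by auto
  have "x < n" "y < n" "z < n" using xyz assms(2) by auto
  then have "(p = x \<and> q = n + y) \<or> (p = n + y \<and> q = 2 * n + z) \<or> (p = x \<and> q = 2 * n + z)"
    using e by (simp add: *)
  then show ?thesis using xyz \<open>x < n\<close> \<open>y < n\<close> \<open>z < n\<close> by auto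
qed

lemma card_3_sorted:
  assumes "card (S :: nat set) = 3"
  obtains p q r where "S = {p, q, r}" "p < q" "q < r"
proof -
  have fin: "finite S" using assms by (intro card_ge_0_finite) simp
  obtain xs where xs: "xs = sorted_list_of_set S" by blast
  have "length xs = 3" using assms xs by simp
  then obtain p q r where "xs = [p, q, r]"
    by (auto simp: numeral_3_eq_3 length_Suc_conv)
  then have pqr: "sorted_list_of_set S = [p, q, r]" using xs by simp
  have "S = {p, q, r}" using set_sorted_list_of_set[OF fin] pqr by simp
  moreover have "p < q" "q < r"
    using strict_sorted_list_of_set[of S] unfolding pqr by auto
  ultimately show ?thesis by (rule that)
qed

text \<open>
  The hypothesis \<open>uniq\<close> says that three triples which pairwise share the entries of a triangle
  coincide; it rules out all triangles except the intended ones.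
\<close>

lemma triangle_tripartite_iff:
  assumes T: "T \<subseteq> {..<n} \<times> {..<n} \<times> {..<n}"
    and uniq: "\<And>x y z x' y' z'. \<lbrakk>(x, y, z') \<in> T; (x, y', z) \<in> T; (x', y, z) \<in> T\<rbrakk>
                 \<Longrightarrow> x' = x \<and> y' = y \<and> z' = z"
  shows "Defs.triangle (tripartite_edges n T) S \<longleftrightarrow>
           (\<exists>x y z. (x, y, z) \<in> T \<and> S = {x, n + y, 2 * n + z})"
proof
  assume S: "Defs.triangle (tripartite_edges n T) S"
  then obtain p q r where pqr: "S = {p, q, r}" "p < q" "q < r"
    using card_3_sorted unfolding Defs.triangle_def by metis
  have E: "{p, q} \<in> tripartite_edges n T" "{q, r} \<in> tripartite_edges n T"
    "{p, r} \<in> tripartite_edges n T"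
    using S pqr unfolding Defs.triangle_def by auto
  note c1 = tripartite_edges_cases[OF E(1) T pqr(2)]
  note c2 = tripartite_edges_cases[OF E(2) T pqr(3)]
  note c3 = tripartite_edges_cases[OF E(3) T less_trans[OF pqr(2,3)]]
  have b: "p < n" "n \<le> q" "q < 2 * n" "2 * n \<le> r" using c1 c2 c3 by linarith+
  obtain z' where 1: "(p, q - n, z') \<in> T" using c1 b by auto
  obtain x' where 2: "(x', q - n, r - 2 * n) \<in> T" using c2 b by auto
  obtain y' where 3: "(p, y', r - 2 * n) \<in> T" using c3 b by auto
  have "(p, q - n, r - 2 * n) \<in> T" using uniq[OF 1 3 2] 1 by simp
  moreover have "S = {p, n + (q - n), 2 * n + (r - 2 * n)}"
    using b pqr(1) by simp
  ultimately show "\<exists>x y z. (x, y, z) \<in> T \<and> S = {x, n + y, 2 * n + z}"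
    by blast
next
  assume "\<exists>x y z. (x, y, z) \<in> T \<and> S = {x, n + y, 2 * n + z}"
  then obtain x y z where xyz: "(x, y, z) \<in> T" and S: "S = {x, n + y, 2 * n + z}" by blast
  have "x < n" "y < n" "z < n" using xyz T by auto
  then have "card S = 3" unfolding S by (simp add: card_3_iff)
  moreover have "{x, n + y} \<in> tripartite_edges n T" "{n + y, 2 * n + z} \<in> tripartite_edges n T"
    "{x, 2 * n + z} \<in> tripartite_edges n T"
    using xyz unfolding tripartite_edges_def by force+
  ultimately show "Defs.triangle (tripartite_edges n T) S"
    unfolding Defs.triangle_def S by (auto simp: insert_commute)
qed

lemma eta_ge_of_triples:
  assumes T: "T \<subseteq> {..<n} \<times> {..<n} \<times> {..<n}"
    and uniq: "\<And>x y z x' y' z'. \<lbrakk>(x, y, z') \<in> T; (x, y', z) \<in> T; (x', y, z) \<in> T\<rbrakk>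
                 \<Longrightarrow> x' = x \<and> y' = y \<and> z' = z"
  shows "eta (3 * n) \<ge> real (card T) / (3 * (real n)\<^sup>2)"
proof -
  let ?E = "tripartite_edges n T"
  have bnd: "x < n \<and> y < n \<and> z < n" if "(x, y, z) \<in> T" for x y z
    using that T by auto
  have finT: "finite T" using T by (rule finite_subset) auto
  have unique_z: "z = z'" if "(x, y, z) \<in> T" "(x, y, z') \<in> T" for x y z z'
    using uniq[OF that(2) that(1) that(1)] by simp
  have unique_y: "y = y'" if "(x, y, z) \<in> T" "(x, y', z) \<in> T" for x y y' z
    using uniq[OF that(1) that(2) that(1)] by simp
  have unique_x: "x = x'" if "(x, y, z) \<in> T" "(x', y, z) \<in> T" for x x' y z
    using uniq[OF that(1) that(1) that(2)] by simp
  note tri = triangle_tripartite_iff[OF T uniq]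
  have sg: "simple_graph {..<3 * n} ?E"
    unfolding simple_graph_def
  proof (intro conjI ballI)
    fix e assume "e \<in> ?E"
    then obtain x y z where xyz: "(x, y, z) \<in> T"
      and e: "e = {x, n + y} \<or> e = {n + y, 2 * n + z} \<or> e = {x, 2 * n + z}"
      unfolding tripartite_edges_def by auto
    show "e \<subseteq> {..<3 * n}" "card e = 2" using e bnd[OF xyz] by auto
  qed simp
  have ut: "edges_in_unique_triangle ?E"
    unfolding edges_in_unique_triangle_def
  proof
    fix e assume "e \<in> ?E"
    then obtain x y z where xyz: "(x, y, z) \<in> T"
      and e: "e = {x, n + y} \<or> e = {n + y, 2 * n + z} \<or> e = {x, 2 * n + z}"
      unfolding tripartite_edges_def by auto
    show "\<exists>!S. Defs.triangle ?E S \<and> e \<subseteq> S"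
    proof (rule ex1I[of _ "{x, n + y, 2 * n + z}"])
      show "Defs.triangle ?E {x, n + y, 2 * n + z} \<and> e \<subseteq> {x, n + y, 2 * n + z}"
        using xyz e by (auto simp: tri)
    next
      fix S assume S: "Defs.triangle ?E S \<and> e \<subseteq> S"
      then obtain x' y' z' where xyz': "(x', y', z') \<in> T" "S = {x', n + y', 2 * n + z'}"
        by (auto simp: tri)
      have sub: "e \<subseteq> {x', n + y', 2 * n + z'}" using S xyz'(2) by simp
      from e show "S = {x, n + y, 2 * n + z}"
      proof (elim disjE)
        assume "e = {x, n + y}"
        then have "x = x'" "y = y'" using sub bnd[OF xyz] bnd[OF xyz'(1)] by auto
        then show ?thesis using unique_z xyz xyz' by blast
      next
        assume "e = {n + y, 2 * n + z}"
        then have "y = y'" "z = z'" using sub bnd[OF xyz] bnd[OF xyz'(1)] by auto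
        then show ?thesis using unique_x xyz xyz' by blast
      next
        assume "e = {x, 2 * n + z}"
        then have "x = x'" "z = z'" using sub bnd[OF xyz] bnd[OF xyz'(1)] by auto
        then show ?thesis using unique_y xyz xyz' by blast
      qed
    qed
  qed
  let ?f = "\<lambda>(x, y, z :: nat). {x, n + y}" and ?g = "\<lambda>(x :: nat, y, z). {n + y, 2 * n + z}"
    and ?h = "\<lambda>(x, y :: nat, z). {x, 2 * n + z}"
  have "inj_on ?f T" "inj_on ?g T" "inj_on ?h T"
    using bnd unique_x unique_y unique_z
    by (fastforce simp: inj_on_def doubleton_eq_iff)+
  then have c: "card (?f ` T) = card T" "card (?g ` T) = card T" "card (?h ` T) = card T"
    by (simp_all add: card_image)
  have "(?f ` T) \<inter> (?g ` T) = {}" "(?f ` T \<union> ?g ` T) \<inter> (?h ` T) = {}"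
    using bnd by (fastforce simp: doubleton_eq_iff)+
  then have "card ?E = 3 * card T"
    unfolding tripartite_edges_def using finT c by (simp add: card_Un_disjoint)
  then show ?thesis using eta_ge[OF sg _ ut] by (simp add: power2_eq_square field_simps)
qed

section \<open>Gaussian integrals and sums\<close>
text \<open>The primitive of \<open>exp (- t\<^sup>2)\<close> vanishing at 0, meant for nonnegative arguments.\<close>

definition gint :: "real \<Rightarrow> real" where
  "gint x = integral {0..x} (\<lambda>t. exp (- t\<^sup>2))"

lemma gint_diff:
  assumes "0 \<le> a" "a \<le> b"
  shows "(b - a) * exp (- b\<^sup>2) \<le> gint b - gint a" "gint b - gint a \<le> (b - a) * exp (- a\<^sup>2)"
proof -
  have int: "(\<lambda>t::real. exp (- t\<^sup>2)) integrable_on {u..v}" for u v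
    by (intro integrable_continuous_real continuous_intros)
  have eq: "gint b - gint a = integral {a..b} (\<lambda>t. exp (- t\<^sup>2))"
    unfolding gint_def using Henstock_Kurzweil_Integration.integral_combine[OF assms int] by simp
  have "integral {a..b} (\<lambda>t. exp (- b\<^sup>2)) \<le> integral {a..b} (\<lambda>t. exp (- t\<^sup>2))"
    by (rule integral_le[OF _ int]) (use assms in auto)
  then show "(b - a) * exp (- b\<^sup>2) \<le> gint b - gint a" using eq assms by simp
  have "integral {a..b} (\<lambda>t. exp (- t\<^sup>2)) \<le> integral {a..b} (\<lambda>t. exp (- a\<^sup>2))"
    by (rule integral_le[OF int]) (use assms in auto)
  then show "gint b - gint a \<le> (b - a) * exp (- a\<^sup>2)" using eq assms by simp
qed

lemma gint_0: "gint 0 = 0"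
  by (simp add: gint_def)

lemma gint_mono: "0 \<le> a \<Longrightarrow> a \<le> b \<Longrightarrow> gint a \<le> gint b"
  using gint_diff(1)[of a b] by (smt (verit) exp_gt_zero mult_nonneg_nonneg)

lemma gint_le_2:
  assumes "0 \<le> x" shows "gint x \<le> 2"
proof -
  have "((\<lambda>t. inverse (1 + t\<^sup>2)) has_integral (arctan x - arctan 0)) {0..x}"
    using assms
    by (intro fundamental_theorem_of_calculus)
       (auto intro!: derivative_eq_intros simp flip: has_real_derivative_iff_has_vector_derivative)
  moreover have "((\<lambda>t. exp (- t\<^sup>2)) has_integral gint x) {0..x}"
    unfolding gint_def
    by (intro integrable_integral integrable_continuous_real continuous_intros)
  moreover have "exp (- t\<^sup>2) \<le> inverse (1 + t\<^sup>2)" for t :: real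
  proof -
    have "1 + t\<^sup>2 \<le> exp (t\<^sup>2)" by simp
    then have "inverse (exp (t\<^sup>2)) \<le> inverse (1 + t\<^sup>2)"
      by (intro le_imp_inverse_le) (auto simp: add_pos_nonneg)
    then show ?thesis by (simp add: exp_minus)
  qed
  ultimately have "gint x \<le> arctan x - arctan 0"
    by (blast intro: has_integral_le)
  then show ?thesis using arctan_ubound[of x] pi_less_4 by simp
qed

text \<open>
  The integral of \<open>exp (- t\<^sup>2)\<close> over the half line. Its value \<open>sqrt pi / 2\<close> plays no role; only the
  scaling of Gaussian integrals and crude bounds matter.
\<close>

definition gauss_const :: real where "gauss_const = (SUP x\<in>{0..}. gint x)"

lemma bdd_gint: "bdd_above (gint ` {0..})"
  using gint_le_2 by (intro bdd_aboveI[of _ 2]) auto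

lemma gint_le_gauss_const: "0 \<le> x \<Longrightarrow> gint x \<le> gauss_const"
  unfolding gauss_const_def by (rule cSUP_upper[OF _ bdd_gint]) auto

lemma gauss_const_bounds: "1 / 3 \<le> gauss_const" "gauss_const \<le> 2"
proof -
  have "1 / 3 \<le> exp (- 1 :: real)" using exp_le by (simp add: exp_minus field_simps)
  also have "\<dots> \<le> gint 1" using gint_diff(1)[of 0 1] gint_0 by simp
  also have "\<dots> \<le> gauss_const" by (rule gint_le_gauss_const) simp
  finally show "1 / 3 \<le> gauss_const" .
  show "gauss_const \<le> 2"
    unfolding gauss_const_def by (rule cSUP_least) (auto intro: gint_le_2)
qed

text \<open>The Gaussian sum of width \<open>\<omega>\<close> over the positive integers up to \<open>K\<close>.\<close>

definition gsum :: "real \<Rightarrow> nat \<Rightarrow> real" where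
  "gsum \<omega> K = (\<Sum>j=1..K. exp (- (real j / \<omega>)\<^sup>2))"

lemma gsum_nonneg: "gsum \<omega> K \<ge> 0"
  unfolding gsum_def by (intro sum_nonneg) auto

lemma gsum_le:
  assumes "\<omega> > 0"
  shows "gsum \<omega> K \<le> \<omega> * gauss_const"
proof -
  have "gsum \<omega> K \<le> \<omega> * gint (real K / \<omega>)"
  proof (induction K)
    case 0
    then show ?case by (simp add: gsum_def gint_0)
  next
    case (Suc K)
    have "(real (Suc K) / \<omega> - real K / \<omega>) * exp (- (real (Suc K) / \<omega>)\<^sup>2)
            \<le> gint (real (Suc K) / \<omega>) - gint (real K / \<omega>)"
      using assms by (intro gint_diff) (auto simp: field_simps)
    moreover have "real (Suc K) / \<omega> - real K / \<omega> = 1 / \<omega>"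
      by (simp add: diff_divide_distrib[symmetric])
    ultimately have "exp (- (real (Suc K) / \<omega>)\<^sup>2)
            \<le> \<omega> * (gint (real (Suc K) / \<omega>) - gint (real K / \<omega>))"
      using assms by (simp add: field_simps)
    then show ?case using Suc unfolding gsum_def by (simp add: algebra_simps)
  qed
  also have "\<dots> \<le> \<omega> * gauss_const"
    using assms by (intro mult_left_mono gint_le_gauss_const) auto
  finally show ?thesis .
qed

lemma gsum_ge:
  assumes "\<omega> > 0"
  shows "eventually (\<lambda>K. gsum \<omega> K \<ge> \<omega> * gauss_const - 2) sequentially"
proof -
  have lower: "gsum \<omega> K \<ge> \<omega> * (gint (real (Suc K) / \<omega>) - gint (1 / \<omega>))" for K
  proof (induction K)
    case 0
    then show ?case by (simp add: gsum_def)
  next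
    case (Suc K)
    have "gint (real (Suc (Suc K)) / \<omega>) - gint (real (Suc K) / \<omega>)
           \<le> (real (Suc (Suc K)) / \<omega> - real (Suc K) / \<omega>) * exp (- (real (Suc K) / \<omega>)\<^sup>2)"
      using assms by (intro gint_diff) (auto simp: field_simps)
    moreover have "real (Suc (Suc K)) / \<omega> - real (Suc K) / \<omega> = 1 / \<omega>"
      by (simp add: diff_divide_distrib[symmetric])
    ultimately have "\<omega> * (gint (real (Suc (Suc K)) / \<omega>) - gint (real (Suc K) / \<omega>))
           \<le> exp (- (real (Suc K) / \<omega>)\<^sup>2)"
      using assms by (simp add: field_simps)
    then show ?case using Suc unfolding gsum_def by (simp add: algebra_simps)
  qed
  have "gauss_const - 1 / \<omega> < (SUP x\<in>{0..}. gint x)"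
    using assms by (simp add: gauss_const_def[symmetric])
  then obtain x where x: "x \<ge> 0" "gauss_const - 1 / \<omega> < gint x"
    by (subst (asm) less_cSUP_iff) (auto intro: bdd_gint)
  have g1: "\<omega> * gint (1 / \<omega>) \<le> 1"
    using gint_diff(2)[of 0 "1 / \<omega>"] assms by (simp add: gint_0 field_simps)
  show ?thesis
    using eventually_ge_at_top[of "nat \<lceil>\<omega> * x\<rceil>"]
  proof eventually_elim
    case (elim K)
    then have "\<omega> * x \<le> real (Suc K)" by linarith
    then have "gint x \<le> gint (real (Suc K) / \<omega>)"
      using x(1) assms by (intro gint_mono) (auto simp: field_simps)
    then have "\<omega> * (gauss_const - 1 / \<omega>) \<le> \<omega> * gint (real (Suc K) / \<omega>)"
      using assms x(2) by (intro mult_left_mono) auto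
    then have "\<omega> * gauss_const - 1 \<le> \<omega> * gint (real (Suc K) / \<omega>)"
      using assms by (simp add: algebra_simps)
    then show ?case using lower[of K] g1 by (simp add: algebra_simps)
  qed
qed

lemma sum_int_half_open:
  fixes F :: "int \<Rightarrow> real"
  shows "(\<Sum>q\<in>{- int K..<int K}. F q) = (\<Sum>j=1..K. F (int j - 1) + F (- int j))"
proof (induction K)
  case 0
  then show ?case by simp
next
  case (Suc K)
  have "{- int (Suc K)..<int (Suc K)} = insert (int K) (insert (- int (Suc K)) {- int K..<int K})"
    by auto
  then show ?case using Suc by simp
qed

lemma sum_int_symmetric:
  fixes F :: "int \<Rightarrow> real"
  shows "(\<Sum>q\<in>{- int K..int K}. F q) = F 0 + (\<Sum>j=1..K. F (int j) + F (- int j))"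
proof (induction K)
  case 0
  then show ?case by simp
next
  case (Suc K)
  have "{- int (Suc K)..int (Suc K)} =
      insert (int (Suc K)) (insert (- int (Suc K)) {- int K..int K})"
    by auto
  then show ?case using Suc by simp
qed

lemma sum_int_gauss:
  "(\<Sum>q\<in>{- int K..int K}. exp (- (real_of_int q / \<omega>)\<^sup>2)) = 1 + 2 * gsum \<omega> K"
  unfolding sum_int_symmetric gsum_def by (simp add: sum_distrib_left)

text \<open>
  Gaussian sums over a shifted lattice, compared with twice the sum over the positive integers.
\<close>

lemma sum_shifted_gauss:
  assumes "\<omega> > 0" "0 \<le> \<beta>" "\<beta> \<le> 1"
  shows "2 * gsum \<omega> K \<le> (\<Sum>q\<in>{- int K..<int K}. exp (- ((real_of_int q + \<beta>) / \<omega>)\<^sup>2))"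
    and "(\<Sum>q\<in>{- int K..<int K}. exp (- ((real_of_int q + \<beta>) / \<omega>)\<^sup>2)) \<le> 2 + 2 * gsum \<omega> K"
proof -
  have mono: "exp (- (v / \<omega>)\<^sup>2) \<le> exp (- (u / \<omega>)\<^sup>2)" if "\<bar>u\<bar> \<le> \<bar>v\<bar>" for u v
    using that assms(1) by (simp add: power_divide divide_right_mono abs_le_square_iff)
  have "2 * gsum \<omega> K = (\<Sum>j=1..K. exp (- (real j / \<omega>)\<^sup>2) + exp (- (real j / \<omega>)\<^sup>2))"
    unfolding gsum_def by (simp add: sum_distrib_left)
  also have "\<dots> \<le> (\<Sum>q\<in>{- int K..<int K}. exp (- ((real_of_int q + \<beta>) / \<omega>)\<^sup>2))"
    unfolding sum_int_half_open by (intro sum_mono add_mono mono) (use assms in auto)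
  finally show "2 * gsum \<omega> K \<le> \<dots>" .
  have "(\<Sum>q\<in>{- int K..<int K}. exp (- ((real_of_int q + \<beta>) / \<omega>)\<^sup>2))
        \<le> (\<Sum>j=1..K. exp (- (real (j - 1) / \<omega>)\<^sup>2) + exp (- (real (j - 1) / \<omega>)\<^sup>2))"
    unfolding sum_int_half_open by (intro sum_mono add_mono mono) (use assms in auto)
  also have "\<dots> = 2 * (\<Sum>j<K. exp (- (real j / \<omega>)\<^sup>2))"
    unfolding sum_distrib_left by (rule sum.reindex_bij_witness[of _ Suc "\<lambda>j. j - 1"]) auto
  also have "(\<Sum>j<K. exp (- (real j / \<omega>)\<^sup>2)) \<le> (\<Sum>j\<in>insert 0 {1..K}. exp (- (real j / \<omega>)\<^sup>2))"
    by (intro sum_mono2) auto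
  also have "\<dots> = 1 + gsum \<omega> K" by (simp add: gsum_def)
  finally show "(\<Sum>q\<in>{- int K..<int K}. exp (- ((real_of_int q + \<beta>) / \<omega>)\<^sup>2)) \<le> 2 + 2 * gsum \<omega> K"
    by simp
qed

text \<open>The Gaussian weight, with parameter \<open>W\<close>, of the zero-sum triple \<open>(u, v, - (u + v))\<close>.\<close>

definition pair_weight :: "real \<Rightarrow> int \<times> int \<Rightarrow> real" where
  "pair_weight W = (\<lambda>(u, v). exp (- real_of_int (u\<^sup>2 + v\<^sup>2 + (u + v)\<^sup>2) / W))"

text \<open>
  A finite set of pairs \<open>(u, v)\<close> over which the weights factorise. Since
  \<open>u\<^sup>2 + v\<^sup>2 + (u + v)\<^sup>2 = 2 (u + v / 2)\<^sup>2 + 3 v\<^sup>2 / 2\<close>, the parameter \<open>q = u + v div 2\<close> is used in place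
  of \<open>u\<close>; then \<open>u + v / 2\<close> is \<open>q\<close> or \<open>q + 1 / 2\<close>.
\<close>

definition pair_box :: "nat \<Rightarrow> (int \<times> int) set" where
  "pair_box K = (\<lambda>(q, v). (q - v div 2, v)) ` ({- int K..<int K} \<times> {- int K..int K})"

lemma finite_pair_box: "finite (pair_box K)"
  unfolding pair_box_def by auto

lemma sum_pair_weight_eq:
  assumes "W > 0"
  shows "(\<Sum>p\<in>pair_box K. pair_weight W p) =
    (\<Sum>v\<in>{- int K..int K}. exp (- (real_of_int v / sqrt (2 * W / 3))\<^sup>2) *
      (\<Sum>q\<in>{- int K..<int K}. exp (- ((real_of_int q + real_of_int (v mod 2) / 2) / sqrt (W / 2))\<^sup>2)))"
proof -
  have inj: "inj_on (\<lambda>(q, v). (q - v div 2, v)) ({- int K..<int K} \<times> {- int K..int K})"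
    by (auto simp: inj_on_def)
  have w: "pair_weight W (q - v div 2, v) = exp (- (real_of_int v / sqrt (2 * W / 3))\<^sup>2) *
      exp (- ((real_of_int q + real_of_int (v mod 2) / 2) / sqrt (W / 2))\<^sup>2)" for q v
  proof -
    have v: "real_of_int v = 2 * real_of_int (v div 2) + real_of_int (v mod 2)"
      by (metis mult_div_mod_eq of_int_add of_int_mult of_int_numeral)
    show ?thesis
      unfolding pair_weight_def using assms
      by (simp add: power_divide v power2_eq_square field_simps flip: exp_add)
  qed
  have "(\<Sum>p\<in>pair_box K. pair_weight W p) =
    (\<Sum>(q, v)\<in>{- int K..<int K} \<times> {- int K..int K}. pair_weight W (q - v div 2, v))"
    unfolding pair_box_def by (subst sum.reindex[OF inj]) (auto intro!: sum.cong)
  also have "\<dots> = (\<Sum>v\<in>{- int K..int K}. \<Sum>q\<in>{- int K..<int K}. pair_weight W (q - v div 2, v))"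
    by (subst sum.swap) (simp add: sum.cartesian_product)
  finally show ?thesis by (simp add: w sum_distrib_left)
qed

lemma sum_pair_weight_bounds:
  assumes "W > 0"
  shows "4 * gsum (sqrt (2 * W / 3)) K * gsum (sqrt (W / 2)) K \<le> (\<Sum>p\<in>pair_box K. pair_weight W p)"
    and "(\<Sum>p\<in>pair_box K. pair_weight W p)
           \<le> (1 + 2 * gsum (sqrt (2 * W / 3)) K) * (2 + 2 * gsum (sqrt (W / 2)) K)"
proof -
  have \<beta>: "0 \<le> real_of_int (v mod 2) / 2" "real_of_int (v mod 2) / 2 \<le> 1" for v :: int
    using pos_mod_bound[of 2 v] by auto
  have \<omega>: "sqrt (W / 2) > 0" using assms by simp
  note b = sum_shifted_gauss[OF \<omega> \<beta>]
  have "(1 + 2 * gsum (sqrt (2 * W / 3)) K) * (2 * gsum (sqrt (W / 2)) K)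
        \<le> (\<Sum>p\<in>pair_box K. pair_weight W p)"
    unfolding sum_pair_weight_eq[OF assms] sum_int_gauss[symmetric] sum_distrib_right
    by (intro sum_mono mult_left_mono b) auto
  moreover have "4 * gsum (sqrt (2 * W / 3)) K * gsum (sqrt (W / 2)) K
      \<le> (1 + 2 * gsum (sqrt (2 * W / 3)) K) * (2 * gsum (sqrt (W / 2)) K)"
    using gsum_nonneg[of "sqrt (W / 2)" K] by (simp add: distrib_right)
  ultimately show "4 * gsum (sqrt (2 * W / 3)) K * gsum (sqrt (W / 2)) K
      \<le> (\<Sum>p\<in>pair_box K. pair_weight W p)" by (rule order_trans[rotated])
  show "(\<Sum>p\<in>pair_box K. pair_weight W p)
           \<le> (1 + 2 * gsum (sqrt (2 * W / 3)) K) * (2 + 2 * gsum (sqrt (W / 2)) K)"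
    unfolding sum_pair_weight_eq[OF assms] sum_int_gauss[symmetric] sum_distrib_right
    by (intro sum_mono mult_left_mono b) auto
qed

section \<open>Zero-sum triples of lattice vectors\<close>
lemma member_le_sum_list_map:
  fixes f :: "'a \<Rightarrow> 'b :: ordered_comm_monoid_add"
  assumes "\<And>x. 0 \<le> f x" "x \<in> set xs"
  shows "f x \<le> (\<Sum>y\<leftarrow>xs. f y)"
  using assms(2)
proof (induction xs)
  case (Cons y ys)
  have "0 \<le> (\<Sum>y\<leftarrow>ys. f y)" by (rule sum_list_nonneg) (use assms(1) in auto)
  then show ?case
    using Cons assms(1)[of y] add_mono[of 0 "f y"] add_mono[of "f x" "f y" 0 "sum_list (map f ys)"]
    by (auto intro: add_increasing add_increasing2)
qed simp

lemma sum_prod_list_power: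
  fixes f :: "'a \<Rightarrow> 'b :: comm_semiring_1"
  assumes "finite A"
  shows "(\<Sum>xs\<in>{xs. set xs \<subseteq> A \<and> length xs = n}. \<Prod>x\<leftarrow>xs. f x) = (\<Sum>x\<in>A. f x) ^ n"
proof (induction n)
  case 0
  have "{xs. set xs \<subseteq> A \<and> length xs = 0} = {[]}" by auto
  then show ?case by simp
next
  case (Suc n)
  let ?L = "{xs. set xs \<subseteq> A \<and> length xs = n}"
  have eq: "{xs. set xs \<subseteq> A \<and> length xs = Suc n} = (\<lambda>(x, xs). x # xs) ` (A \<times> ?L)"
    by (auto simp: length_Suc_conv)
  have "(\<Sum>xs\<in>{xs. set xs \<subseteq> A \<and> length xs = Suc n}. \<Prod>x\<leftarrow>xs. f x)
        = (\<Sum>(x, xs)\<in>A \<times> ?L. f x * (\<Prod>x\<leftarrow>xs. f x))"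
    unfolding eq by (subst sum.reindex) (auto simp: inj_on_def intro!: sum.cong)
  also have "\<dots> = (\<Sum>x\<in>A. f x) * (\<Sum>xs\<in>?L. \<Prod>x\<leftarrow>xs. f x)"
    by (simp add: sum_product sum.cartesian_product)
  finally show ?case using Suc by simp
qed

lemma prod_list_exp: "(\<Prod>x\<leftarrow>xs. exp (g x :: real)) = exp (\<Sum>x\<leftarrow>xs. g x)"
  by (induction xs) (auto simp: exp_add)

text \<open>
  Lattice points in the ball of squared radius \<open>R\<close> about the origin of \<open>\<int>\<^sup>D\<close>. Vectors are lists, so
  that vectors of different dimensions can be concatenated.
\<close>

definition lattice_ball :: "nat \<Rightarrow> int \<Rightarrow> int list set" where
  "lattice_ball D R = {xs. length xs = D \<and> (\<Sum>u\<leftarrow>xs. u\<^sup>2) \<le> R}"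

text \<open>
  Zero-sum triples \<open>(x, y, - (x + y))\<close> of vectors of \<open>\<int>\<^sup>D\<close> with squared norms at most \<open>a\<close>, \<open>b\<close>, \<open>c\<close>.
  A triple is encoded as the list of pairs of corresponding coordinates of \<open>x\<close> and \<open>y\<close>.
\<close>

definition triples :: "nat \<Rightarrow> int \<Rightarrow> int \<Rightarrow> int \<Rightarrow> (int \<times> int) list set" where
  "triples D a b c = {ps. length ps = D \<and> (\<Sum>p\<leftarrow>ps. (fst p)\<^sup>2) \<le> a \<and> (\<Sum>p\<leftarrow>ps. (snd p)\<^sup>2) \<le> b
      \<and> (\<Sum>p\<leftarrow>ps. (fst p + snd p)\<^sup>2) \<le> c}"

lemma abs_le_square_int: "\<bar>u\<bar> \<le> (u :: int)\<^sup>2"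
proof (cases "u = 0")
  case False
  then have "1 * \<bar>u\<bar> \<le> \<bar>u\<bar> * \<bar>u\<bar>" by (intro mult_right_mono) auto
  then show ?thesis by (simp add: power2_eq_square)
qed simp

lemma lattice_ball_subset: "lattice_ball D R \<subseteq> {xs. set xs \<subseteq> {- R..R} \<and> length xs = D}"
proof
  fix xs assume xs: "xs \<in> lattice_ball D R"
  have "u \<in> {- R..R}" if "u \<in> set xs" for u
  proof -
    have "u\<^sup>2 \<le> (\<Sum>u\<leftarrow>xs. u\<^sup>2)" by (rule member_le_sum_list_map[of "\<lambda>u. u\<^sup>2", OF _ that]) simp
    then have "\<bar>u\<bar> \<le> R" using xs abs_le_square_int[of u] unfolding lattice_ball_def by simp
    then show ?thesis by auto
  qed
  then show "xs \<in> {xs. set xs \<subseteq> {- R..R} \<and> length xs = D}"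
    using xs by (auto simp: lattice_ball_def)
qed

lemma finite_lattice_ball: "finite (lattice_ball D R)"
  by (rule finite_subset[OF lattice_ball_subset]) (rule finite_lists_length_eq, simp)

lemma triples_lattice_ball:
  assumes "ps \<in> triples D a b c"
  shows "map fst ps \<in> lattice_ball D a" "map snd ps \<in> lattice_ball D b"
    "map (\<lambda>p. fst p + snd p) ps \<in> lattice_ball D c"
  using assms unfolding triples_def lattice_ball_def
  by (simp_all add: comp_def case_prod_beta)

lemma finite_triples: "finite (triples D a b c)"
proof (rule finite_imageD)
  show "finite ((\<lambda>ps. (map fst ps, map snd ps)) ` triples D a b c)"
    by (rule finite_subset[of _ "lattice_ball D a \<times> lattice_ball D b"])
       (auto simp: triples_lattice_ball finite_lattice_ball)
  show "inj_on (\<lambda>ps. (map fst ps, map snd ps)) (triples D a b c)"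
    by (rule inj_onI) (metis Pair_inject zip_map_fst_snd)
qed

lemma triples_mono:
  "a \<le> a' \<Longrightarrow> b \<le> b' \<Longrightarrow> c \<le> c' \<Longrightarrow> triples D a b c \<subseteq> triples D a' b' c'"
  unfolding triples_def by auto

lemma card_triples_append:
  "card (triples d a b c) * card (triples e a' b' c')
     \<le> card (triples (d + e) (a + a') (b + b') (c + c'))"
proof -
  have "inj_on (\<lambda>(ps, qs). ps @ qs) (triples d a b c \<times> triples e a' b' c')"
    by (auto simp: inj_on_def triples_def)
  moreover have "(\<lambda>(ps, qs). ps @ qs) ` (triples d a b c \<times> triples e a' b' c')
      \<subseteq> triples (d + e) (a + a') (b + b') (c + c')"
    by (auto simp: triples_def add_mono)
  ultimately have "card (triples d a b c \<times> triples e a' b' c')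
      \<le> card (triples (d + e) (a + a') (b + b') (c + c'))"
    by (rule card_inj_on_le) (rule finite_triples)
  then show ?thesis by (simp add: card_cartesian_product)
qed

lemma card_triples_rotate: "card (triples d a b c) \<le> card (triples d b c a)"
proof (rule card_inj_on_le)
  let ?f = "\<lambda>p. (snd p, - (fst p + snd p)) :: int \<times> int"
  have "inj ?f" by (auto simp: inj_def prod_eq_iff)
  then show "inj_on (map ?f) (triples d a b c)"
    by (simp add: inj_on_subset[OF inj_mapI])
  show "map ?f ` triples d a b c \<subseteq> triples d b c a"
  proof
    fix qs assume "qs \<in> map ?f ` triples d a b c"
    then obtain ps where ps: "ps \<in> triples d a b c" "qs = map ?f ps" by blast
    have "(\<Sum>p\<leftarrow>qs. (fst p)\<^sup>2) = (\<Sum>p\<leftarrow>ps. (snd p)\<^sup>2)"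
      unfolding ps(2) by (simp add: comp_def case_prod_beta)
    moreover have "(\<Sum>p\<leftarrow>qs. (snd p)\<^sup>2) = (\<Sum>p\<leftarrow>ps. (fst p + snd p)\<^sup>2)"
      unfolding ps(2) by (simp add: comp_def case_prod_beta power2_eq_square algebra_simps)
    moreover have "(\<Sum>p\<leftarrow>qs. (fst p + snd p)\<^sup>2) = (\<Sum>p\<leftarrow>ps. (fst p)\<^sup>2)"
      unfolding ps(2) by (simp add: comp_def case_prod_beta)
    ultimately show "qs \<in> triples d b c a"
      using ps unfolding triples_def by auto
  qed
qed (rule finite_triples)

lemma card_triples_single:
  "real (card (triples 1 (int w ^ 2) (int w ^ 2) (int w ^ 2))) \<ge> (real w)\<^sup>2 / 4"
proof -
  let ?A = "{0..int (w div 2)} \<times> {0..int (w div 2)}"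
  have "(\<lambda>p. [p]) ` ?A \<subseteq> triples 1 (int w ^ 2) (int w ^ 2) (int w ^ 2)"
  proof clarify
    fix u v assume uv: "u \<in> {0..int (w div 2)}" "v \<in> {0..int (w div 2)}"
    have "u \<le> int w" "v \<le> int w" "u + v \<le> int w" using uv by auto
    then show "[(u, v)] \<in> triples 1 (int w ^ 2) (int w ^ 2) (int w ^ 2)"
      using uv unfolding triples_def by (auto intro!: power_mono)
  qed
  then have "card ((\<lambda>p. [p]) ` ?A) \<le> card (triples 1 (int w ^ 2) (int w ^ 2) (int w ^ 2))"
    by (intro card_mono finite_triples)
  moreover have "card ((\<lambda>p. [p]) ` ?A) = (w div 2 + 1)\<^sup>2"
    by (subst card_image) (auto simp: inj_on_def card_cartesian_product power2_eq_square nat_add_distrib)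
  ultimately have "real ((w div 2 + 1)\<^sup>2) \<le> real (card (triples 1 (int w ^ 2) (int w ^ 2) (int w ^ 2)))"
    by linarith
  moreover have "(real w / 2)\<^sup>2 \<le> (real (w div 2 + 1))\<^sup>2"
  proof (rule power_mono)
    have "w \<le> 2 * (w div 2 + 1)" by presburger
    then show "real w / 2 \<le> real (w div 2 + 1)" by linarith
  qed simp
  ultimately show ?thesis by (simp add: power_divide)
qed

lemma card_triples_power:
  "real (card (triples r (int r * int w ^ 2) (int r * int w ^ 2) (int r * int w ^ 2))) \<ge> ((real w)\<^sup>2 / 4) ^ r"
proof (induction r)
  case 0
  have "triples 0 0 0 0 = {[]}" by (auto simp: triples_def)
  then show ?case by simp
next
  case (Suc r)
  let ?P = "\<lambda>d x. card (triples d x x x)"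
  have "((real w)\<^sup>2 / 4) ^ Suc r \<le> real (?P 1 (int w ^ 2)) * real (?P r (int r * int w ^ 2))"
    unfolding power_Suc by (intro mult_mono card_triples_single Suc) auto
  also have "\<dots> \<le> real (?P (1 + r) (int w ^ 2 + int r * int w ^ 2))"
    unfolding of_nat_mult[symmetric] of_nat_le_iff by (rule card_triples_append)
  finally show ?case by (simp add: algebra_simps)
qed

text \<open>
  Concatenating a triple of type \<open>(a, b, c)\<close> with triples of types \<open>(b, c, a)\<close> and \<open>(c, a, b)\<close> makes
  the three norm bounds equal.
\<close>

lemma card_triples_threefold:
  assumes "a \<ge> 0" "b \<ge> 0" "c \<ge> 0"
  shows "card (triples m a b c) ^ 3 \<le> card (triples (3 * m) (a + b + c) (a + b + c) (a + b + c))"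
proof -
  have "card (triples m a b c) ^ 3 =
      card (triples m a b c) * card (triples m a b c) * card (triples m a b c)"
    by (simp add: power3_eq_cube)
  also have "\<dots> \<le> card (triples m a b c) * card (triples m b c a) * card (triples m c a b)"
    using card_triples_rotate[of m a b c] card_triples_rotate[of m b c a]
    by (intro mult_mono) auto
  also have "\<dots> \<le> card (triples (m + m) (a + b) (b + c) (c + a)) * card (triples m c a b)"
    by (intro mult_right_mono card_triples_append) auto
  also have "\<dots> \<le> card (triples (m + m + m) (a + b + c) (b + c + a) (c + a + b))"
    by (rule card_triples_append)
  also have "m + m + m = 3 * m" by simp
  finally show ?thesis by (simp add: add_ac)
qed

text \<open>
  Each point of the ball has Gaussian weight at least \<open>exp (- R / \<omega>\<^sup>2)\<close>, and the total weight is a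
  product of one-dimensional sums.
\<close>

lemma card_lattice_ball_le:
  assumes "\<omega> > 0"
  shows "real (card (lattice_ball D R)) \<le> exp (real_of_int R / \<omega>\<^sup>2) * (1 + 2 * \<omega> * gauss_const) ^ D"
proof (cases "R \<ge> 0")
  case False
  have "lattice_ball D R = {}"
  proof -
    have "0 \<le> (\<Sum>u\<leftarrow>xs. u\<^sup>2)" for xs :: "int list" by (rule sum_list_nonneg) auto
    then have "\<not> (\<Sum>u\<leftarrow>xs. u\<^sup>2) \<le> R" for xs :: "int list"
      using False order_trans by blast
    then show ?thesis unfolding lattice_ball_def by auto
  qed
  then show ?thesis using assms gauss_const_bounds by auto
next
  case True
  define K where "K = nat R"
  let ?f = "\<lambda>u :: int. exp (- (real_of_int u / \<omega>)\<^sup>2)"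
  have K: "int K = R" using True by (simp add: K_def)
  have weight: "1 \<le> exp (real_of_int R / \<omega>\<^sup>2) * (\<Prod>u\<leftarrow>xs. ?f u)" if "xs \<in> lattice_ball D R" for xs
  proof -
    have "(\<Sum>u\<leftarrow>xs. (real_of_int u / \<omega>)\<^sup>2) = real_of_int (\<Sum>u\<leftarrow>xs. u\<^sup>2) / \<omega>\<^sup>2"
      by (induction xs) (auto simp: power_divide add_divide_distrib)
    also have "\<dots> \<le> real_of_int R / \<omega>\<^sup>2"
      using that by (intro divide_right_mono) (auto simp: lattice_ball_def)
    finally have "(\<Sum>u\<leftarrow>xs. (real_of_int u / \<omega>)\<^sup>2) \<le> real_of_int R / \<omega>\<^sup>2" .
    moreover have "(\<Sum>u\<leftarrow>xs. - (real_of_int u / \<omega>)\<^sup>2) = - (\<Sum>u\<leftarrow>xs. (real_of_int u / \<omega>)\<^sup>2)"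
      by (induction xs) auto
    ultimately show ?thesis by (simp add: prod_list_exp flip: exp_add)
  qed
  have "real (card (lattice_ball D R)) = (\<Sum>xs\<in>lattice_ball D R. 1)" by simp
  also have "\<dots> \<le> (\<Sum>xs\<in>lattice_ball D R. exp (real_of_int R / \<omega>\<^sup>2) * (\<Prod>u\<leftarrow>xs. ?f u))"
    by (intro sum_mono weight)
  also have "\<dots> \<le> (\<Sum>xs\<in>{xs. set xs \<subseteq> {- R..R} \<and> length xs = D}.
      exp (real_of_int R / \<omega>\<^sup>2) * (\<Prod>u\<leftarrow>xs. ?f u))"
    by (intro sum_mono2 lattice_ball_subset finite_lists_length_eq) (auto simp: prod_list_exp)
  also have "\<dots> = exp (real_of_int R / \<omega>\<^sup>2) * (\<Sum>u\<in>{- int K..int K}. ?f u) ^ D"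
    unfolding K by (subst sum_prod_list_power[symmetric]) (auto simp: sum_distrib_left)
  also have "\<dots> \<le> exp (real_of_int R / \<omega>\<^sup>2) * (1 + 2 * \<omega> * gauss_const) ^ D"
    unfolding sum_int_gauss using gsum_le[OF assms, of K] gsum_nonneg[of \<omega> K]
    by (intro mult_left_mono power_mono) auto
  finally show ?thesis .
qed

text \<open>
  Adding an offset to a dilated coordinate multiplies its square by at most \<open>1 + 1 / D\<close>, up to
  an additive error that does not depend on the coordinate. The offset \<open>e\<close> may be as large as \<open>2 * \<kappa>\<close> because
  the third vector of a triple collects two offsets.
\<close>

lemma square_dilate_le:
  fixes u e \<kappa> :: int
  assumes "0 \<le> e" "e \<le> 2 * \<kappa>" "D \<ge> 0"
  shows "D * (\<kappa> * u + e)\<^sup>2 \<le> \<kappa>\<^sup>2 * ((D + 1) * u\<^sup>2 + 4 * D * (D + 1))"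
proof -
  have "\<bar>\<kappa> * u + e\<bar> \<le> \<kappa> * (\<bar>u\<bar> + 2)"
    using assms abs_triangle_ineq[of "\<kappa> * u" e] by (simp add: abs_mult algebra_simps)
  then have "(\<kappa> * u + e)\<^sup>2 \<le> (\<kappa> * (\<bar>u\<bar> + 2))\<^sup>2"
    by (metis abs_ge_zero power2_abs power_mono)
  then have "D * (\<kappa> * u + e)\<^sup>2 \<le> D * (\<kappa> * (\<bar>u\<bar> + 2))\<^sup>2"
    using assms by (intro mult_left_mono)
  also have "\<dots> = \<kappa>\<^sup>2 * (D * (\<bar>u\<bar> + 2)\<^sup>2)" by (simp add: power_mult_distrib)
  also have "D * (\<bar>u\<bar> + 2)\<^sup>2 \<le> (D + 1) * u\<^sup>2 + 4 * D * (D + 1)"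
    \<comment> \<open>the difference of the two sides is \<open>(|u| - 2 * D)\<^sup>2\<close>\<close>
    using zero_le_power2[of "\<bar>u\<bar> - 2 * D"] by (simp add: power2_eq_square algebra_simps)
  finally show ?thesis by (simp add: mult_left_mono)
qed

lemma sum_list_dilate_le:
  fixes f :: "'a \<Rightarrow> int" and g :: "'a \<Rightarrow> int"
  assumes "\<And>x. x \<in> set xs \<Longrightarrow> 0 \<le> g x \<and> g x \<le> 2 * \<kappa>" "D > 0" "length xs = nat D"
    and "(\<Sum>x\<leftarrow>xs. (f x)\<^sup>2) \<le> R" "(D + 1) * R + 4 * D\<^sup>2 * (D + 1) \<le> D * R'"
  shows "(\<Sum>x\<leftarrow>xs. (\<kappa> * f x + g x)\<^sup>2) \<le> \<kappa>\<^sup>2 * R'"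
proof -
  have "D * (\<Sum>x\<leftarrow>xs. (\<kappa> * f x + g x)\<^sup>2)
      \<le> \<kappa>\<^sup>2 * ((D + 1) * (\<Sum>x\<leftarrow>xs. (f x)\<^sup>2) + 4 * D * (D + 1) * int (length xs))"
    using assms(1)
  proof (induction xs)
    case (Cons x xs)
    then have IH: "D * (\<Sum>x\<leftarrow>xs. (\<kappa> * f x + g x)\<^sup>2)
      \<le> \<kappa>\<^sup>2 * ((D + 1) * (\<Sum>x\<leftarrow>xs. (f x)\<^sup>2) + 4 * D * (D + 1) * int (length xs))" by simp
    have "D * (\<kappa> * f x + g x)\<^sup>2 \<le> \<kappa>\<^sup>2 * ((D + 1) * (f x)\<^sup>2 + 4 * D * (D + 1))"
      using Cons.prems[of x] assms(2) by (intro square_dilate_le) auto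
    with IH show ?case by (simp add: algebra_simps)
  qed simp
  also have "\<dots> \<le> \<kappa>\<^sup>2 * ((D + 1) * R + 4 * D * (D + 1) * int (length xs))"
    using assms by (intro mult_left_mono add_mono) auto
  also have "\<dots> = \<kappa>\<^sup>2 * ((D + 1) * R + 4 * D\<^sup>2 * (D + 1))"
    using assms by (simp add: power2_eq_square algebra_simps)
  also have "\<dots> \<le> \<kappa>\<^sup>2 * (D * R')" using assms by (intro mult_left_mono) auto
  finally show ?thesis using assms(2) by (simp add: mult.left_commute)
qed

text \<open>
  A triple \<open>(x, y)\<close> and offset vectors \<open>e, f\<close> with entries in \<open>{0..<\<kappa>}\<close> give the triple
  \<open>(\<kappa> x + e, \<kappa> y + f)\<close>, and all of these are distinct.
\<close>

lemma card_triples_dilate: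
  assumes "D > 0" "\<kappa> > 0" "(int D + 1) * R + 4 * (int D)\<^sup>2 * (int D + 1) \<le> int D * R'"
  shows "card (triples D R R R) * (\<kappa>\<^sup>2) ^ D
           \<le> card (triples D (int \<kappa> ^ 2 * R') (int \<kappa> ^ 2 * R') (int \<kappa> ^ 2 * R'))"
proof -
  let ?I = "{0..<int \<kappa>} \<times> {0..<int \<kappa>}"
  let ?E = "{es. set es \<subseteq> ?I \<and> length es = D}"
  let ?h = "\<lambda>z. (int \<kappa> * fst (fst z) + fst (snd z), int \<kappa> * snd (fst z) + snd (snd z))"
  let ?F = "\<lambda>(ps, es). map ?h (zip ps es)"
  let ?S = "triples D (int \<kappa> ^ 2 * R') (int \<kappa> ^ 2 * R') (int \<kappa> ^ 2 * R')"
  have "card ?E = (\<kappa>\<^sup>2) ^ D"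
    by (subst card_lists_length_eq) (auto simp: card_cartesian_product power2_eq_square)
  have inj_h: "p = p' \<and> q = q'" if "?h (p, q) = ?h (p', q')" "q \<in> ?I" "q' \<in> ?I" for p p' q q'
  proof -
    have div: "(int \<kappa> * x + e) div int \<kappa> = x" if "0 \<le> e" "e < int \<kappa>" for x e
      using that by simp
    have *: "x = y \<and> e = f"
      if "int \<kappa> * x + e = int \<kappa> * y + f" "e \<in> {0..<int \<kappa>}" "f \<in> {0..<int \<kappa>}" for x y e f
    proof -
      have "x = y" using div[of e x] div[of f y] that by simp
      then show ?thesis using that by simp
    qed
    have "fst p = fst p' \<and> fst q = fst q'" "snd p = snd p' \<and> snd q = snd q'"
      by (rule *; use that in auto)+
    then show ?thesis by (simp add: prod_eq_iff)
  qed
  have "inj_on ?F (triples D R R R \<times> ?E)"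
  proof (rule inj_onI)
    fix x y assume "x \<in> triples D R R R \<times> ?E" "y \<in> triples D R R R \<times> ?E" "?F x = ?F y"
    moreover obtain ps es ps' es' where xy: "x = (ps, es)" "y = (ps', es')" by fastforce
    ultimately have a: "ps \<in> triples D R R R" "ps' \<in> triples D R R R" "set es \<subseteq> ?I" "set es' \<subseteq> ?I"
      "length es' = length es" "D = length es" and eq: "map ?h (zip ps es) = map ?h (zip ps' es')"
      by auto
    have l: "length ps = length es" "length ps' = length es"
      using a by (auto simp: triples_def)
    have "ps ! i = ps' ! i \<and> es ! i = es' ! i" if "i < length es" for i
    proof -
      have "map ?h (zip ps es) ! i = map ?h (zip ps' es') ! i" using eq by simp
      then have "?h (ps ! i, es ! i) = ?h (ps' ! i, es' ! i)"
        using that l a(5) by simp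
      moreover have "es ! i \<in> ?I" "es' ! i \<in> ?I"
        using that a(3,4,5) nth_mem by (metis subsetD)+
      ultimately show ?thesis by (rule inj_h)
    qed
    then show "x = y" using l a(5) xy by (auto intro: nth_equalityI)
  qed
  moreover have "?F ` (triples D R R R \<times> ?E) \<subseteq> ?S"
  proof (rule image_subsetI)
    fix x assume "x \<in> triples D R R R \<times> ?E"
    moreover obtain ps es where x: "x = (ps, es)" by fastforce
    ultimately have ps: "ps \<in> triples D R R R" and es: "set es \<subseteq> ?I" "D = length es" by auto
    have l: "length ps = length es" using ps es by (simp add: triples_def)
    let ?zs = "zip ps es"
    have mem: "0 \<le> fst (snd z)" "fst (snd z) < int \<kappa>" "0 \<le> snd (snd z)" "snd (snd z) < int \<kappa>"
      if "z \<in> set ?zs" for z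
    proof -
      have "snd z \<in> ?I" using that es(1) set_zip_rightD[of "fst z" "snd z" ps es] by auto
      then show "0 \<le> fst (snd z)" "fst (snd z) < int \<kappa>" "0 \<le> snd (snd z)" "snd (snd z) < int \<kappa>"
        by (auto simp: mem_Times_iff)
    qed
    have s: "(\<Sum>z\<leftarrow>?zs. g (fst z)) = (\<Sum>p\<leftarrow>ps. g p)" for g :: "int \<times> int \<Rightarrow> int"
    proof -
      have "(\<Sum>z\<leftarrow>?zs. g (fst z)) = sum_list (map g (map fst ?zs))" by (simp add: comp_def)
      then show ?thesis using map_fst_zip[OF l] by simp
    qed
    have b: "(\<Sum>z\<leftarrow>?zs. (int \<kappa> * g (fst z) + k z)\<^sup>2) \<le> int \<kappa> ^ 2 * R'"
      if "(\<Sum>p\<leftarrow>ps. (g p)\<^sup>2) \<le> R" "\<And>z. z \<in> set ?zs \<Longrightarrow> 0 \<le> k z \<and> k z \<le> 2 * int \<kappa>" for g k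
      by (rule sum_list_dilate_le[where D = "int D" and R = R, OF that(2)])
         (use that(1) assms s[of "\<lambda>p. (g p)\<^sup>2"] l es(2) in auto)
    have sums: "(\<Sum>p\<leftarrow>ps. (fst p)\<^sup>2) \<le> R" "(\<Sum>p\<leftarrow>ps. (snd p)\<^sup>2) \<le> R"
      "(\<Sum>p\<leftarrow>ps. (fst p + snd p)\<^sup>2) \<le> R"
      using ps by (auto simp: triples_def)
    note b1 = b[OF sums(1), of "\<lambda>z. fst (snd z)"]
    note b2 = b[OF sums(2), of "\<lambda>z. snd (snd z)"]
    note b3 = b[OF sums(3), of "\<lambda>z. fst (snd z) + snd (snd z)"]
    have "(\<Sum>p\<leftarrow>map ?h ?zs. (fst p)\<^sup>2) \<le> int \<kappa> ^ 2 * R'"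
      using b1 mem by (fastforce simp: comp_def)
    moreover have "(\<Sum>p\<leftarrow>map ?h ?zs. (snd p)\<^sup>2) \<le> int \<kappa> ^ 2 * R'"
      using b2 mem by (fastforce simp: comp_def)
    moreover have "(\<Sum>p\<leftarrow>map ?h ?zs. (fst p + snd p)\<^sup>2) \<le> int \<kappa> ^ 2 * R'"
      using b3 mem by (fastforce simp: comp_def algebra_simps)
    ultimately show "?F x \<in> ?S"
      using l es(2) x unfolding triples_def by simp
  qed
  ultimately have "card (triples D R R R \<times> ?E) \<le> card ?S"
    by (rule card_inj_on_le) (rule finite_triples)
  then show ?thesis using \<open>card ?E = _\<close> by (simp add: card_cartesian_product)
qed

section \<open>Triples in a ball give triangles\<close>
lemma pigeonhole_sum:
  fixes w :: "'a \<Rightarrow> real"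
  assumes "finite S" "finite C" "C \<noteq> {}" "f ` S \<subseteq> C"
  obtains y where "y \<in> C" "(\<Sum>x\<in>S. w x) \<le> real (card C) * (\<Sum>x | x \<in> S \<and> f x = y. w x)"
proof -
  have "\<exists>y\<in>C. (\<Sum>x\<in>S. w x) \<le> real (card C) * (\<Sum>x | x \<in> S \<and> f x = y. w x)"
  proof (rule ccontr)
    assume "\<not> ?thesis"
    then have *: "(\<Sum>x | x \<in> S \<and> f x = y. w x) < (\<Sum>x\<in>S. w x) / real (card C)" if "y \<in> C" for y
      using that assms(2,3) by (force simp: card_gt_0_iff field_simps)
    have "(\<Sum>x\<in>S. w x) = (\<Sum>y\<in>C. \<Sum>x | x \<in> S \<and> f x = y. w x)"
      using sum.group[OF assms(1,2,4), of w] by simp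
    also have "\<dots> < (\<Sum>y\<in>C. (\<Sum>x\<in>S. w x) / real (card C))"
      using assms * by (intro sum_strict_mono) auto
    also have "\<dots> = (\<Sum>x\<in>S. w x)" using assms by simp
    finally show False by simp
  qed
  then show ?thesis using that by blast
qed

text \<open>
  With \<open>d = z - x - y\<close> the hypotheses say that \<open>x - y\<close>, \<open>x - y - d\<close> and \<open>x - y + d\<close> have the same
  norm.
\<close>

lemma parallelogram_zero:
  fixes x y z :: "int list"
  assumes "(\<Sum>i<D. (x ! i - y ! i)\<^sup>2) = r" "(\<Sum>i<D. (x ! i - (z ! i - x ! i))\<^sup>2) = r"
    "(\<Sum>i<D. ((z ! i - y ! i) - y ! i)\<^sup>2) = r"
  shows "\<forall>i<D. z ! i = x ! i + y ! i"
proof -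
  have "2 * (\<Sum>i<D. (z ! i - x ! i - y ! i)\<^sup>2) =
      (\<Sum>i<D. (x ! i - (z ! i - x ! i))\<^sup>2) + (\<Sum>i<D. ((z ! i - y ! i) - y ! i)\<^sup>2)
      - 2 * (\<Sum>i<D. (x ! i - y ! i)\<^sup>2)"
    unfolding sum_distrib_left sum.distrib[symmetric] sum_subtractf[symmetric]
    by (intro sum.cong) (simp_all add: power2_eq_square algebra_simps)
  then have "(\<Sum>i<D. (z ! i - x ! i - y ! i)\<^sup>2) = 0" using assms by simp
  then have "\<forall>i\<in>{..<D}. (z ! i - x ! i - y ! i)\<^sup>2 = 0" by (subst (asm) sum_nonneg_eq_0_iff) auto
  then show ?thesis by (auto simp: diff_eq_eq add.commute)
qed

text \<open>
  Three edges forming a triangle in the graph of the triples \<open>(x, y, x + y)\<close> with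
  \<open>|x - y|\<^sup>2 = r\<close> come from a single triple.
\<close>

lemma pseudo_triangle_trivial:
  fixes x y z x' y' z' :: "int list"
  assumes len: "length x = D" "length y = D" "length z = D" "length x' = D" "length y' = D" "length z' = D"
    and add: "\<And>i. i < D \<Longrightarrow> z' ! i = x ! i + y ! i" "\<And>i. i < D \<Longrightarrow> z ! i = x ! i + y' ! i"
      "\<And>i. i < D \<Longrightarrow> z ! i = x' ! i + y ! i"
    and dist: "(\<Sum>i<D. (x ! i - y ! i)\<^sup>2) = r" "(\<Sum>i<D. (x ! i - y' ! i)\<^sup>2) = r"
      "(\<Sum>i<D. (x' ! i - y ! i)\<^sup>2) = r"
  shows "x' = x \<and> y' = y \<and> z' = z"
proof -
  have "(\<Sum>i<D. (x ! i - (z ! i - x ! i))\<^sup>2) = r"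
    unfolding dist(2)[symmetric] by (rule sum.cong) (simp_all add: add(2))
  moreover have "(\<Sum>i<D. ((z ! i - y ! i) - y ! i)\<^sup>2) = r"
    unfolding dist(3)[symmetric] by (rule sum.cong) (simp_all add: add(3))
  ultimately have z: "\<forall>i<D. z ! i = x ! i + y ! i"
    by (rule parallelogram_zero[OF dist(1)])
  have "x' ! i = x ! i" "y' ! i = y ! i" "z' ! i = z ! i" if "i < D" for i
    using z[rule_format, OF that] add(1)[OF that] add(2)[OF that] add(3)[OF that] by linarith+
  then show ?thesis using len by (auto intro!: nth_equalityI)
qed

text \<open>The factor \<open>4 * R + 1\<close> is the number of possible values of \<open>|x - y|\<^sup>2\<close> for \<open>x, y\<close> in the ball.\<close>

lemma eta_ge_of_ball:
  assumes "card (lattice_ball D R) \<le> n" "R \<ge> 0"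
  shows "eta (3 * n) \<ge> real (card (triples D R R R)) / ((4 * real_of_int R + 1) * (3 * (real n)\<^sup>2))"
proof -
  let ?P = "triples D R R R" and ?B = "lattice_ball D R"
  let ?\<delta> = "\<lambda>ps :: (int \<times> int) list. \<Sum>p\<leftarrow>ps. (fst p - snd p)\<^sup>2"
  have img: "?\<delta> ` ?P \<subseteq> {0..4 * R}"
  proof (rule image_subsetI)
    fix ps assume ps: "ps \<in> ?P"
    have "?\<delta> ps \<le> 2 * (\<Sum>p\<leftarrow>ps. (fst p)\<^sup>2) + 2 * (\<Sum>p\<leftarrow>ps. (snd p)\<^sup>2)"
    proof (induction ps)
      case (Cons p ps)
      have "(fst p - snd p)\<^sup>2 \<le> 2 * (fst p)\<^sup>2 + 2 * (snd p)\<^sup>2"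
        using zero_le_power2[of "fst p + snd p"] by (simp add: power2_eq_square algebra_simps)
      then show ?case using Cons by simp
    qed simp
    moreover have "0 \<le> ?\<delta> ps" by (rule sum_list_nonneg) auto
    ultimately show "?\<delta> ps \<in> {0..4 * R}" using ps by (auto simp: triples_def)
  qed
  \<comment> \<open>\<open>r\<close> is a most popular value of the squared distance\<close>
  obtain r where r: "(\<Sum>ps\<in>?P. 1 :: real) \<le> real (card {0..4 * R}) * (\<Sum>ps | ps \<in> ?P \<and> ?\<delta> ps = r. 1)"
    by (rule pigeonhole_sum[OF finite_triples _ _ img, where w = "\<lambda>_. 1"]) (use assms(2) in auto)
  define S where "S = {ps \<in> ?P. ?\<delta> ps = r}"
  have S: "real (card ?P) \<le> (4 * real_of_int R + 1) * real (card S)"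
    using r assms(2) unfolding S_def by simp
  let ?X = "map fst" and ?Y = "map snd" and ?Z = "map (\<lambda>p :: int \<times> int. fst p + snd p)"
  obtain g where g: "inj_on g ?B" "g ` ?B \<subseteq> {..<n}"
    using card_le_inj[OF finite_lattice_ball, of "{..<n}" D R] assms(1) by auto
  define T where "T = (\<lambda>ps. (g (?X ps), g (?Y ps), g (?Z ps))) ` S"
  have B: "?X ps \<in> ?B" "?Y ps \<in> ?B" "?Z ps \<in> ?B" if "ps \<in> S" for ps
    using that triples_lattice_ball[of ps D R R R] unfolding S_def by auto
  have geq: "xs = ys" if "g xs = g ys" "xs \<in> ?B" "ys \<in> ?B" for xs ys
    using that g(1) by (auto simp: inj_on_def)
  have "inj_on (\<lambda>ps. (g (?X ps), g (?Y ps), g (?Z ps))) S"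
  proof (rule inj_onI)
    fix ps qs assume pq: "ps \<in> S" "qs \<in> S"
      "(g (?X ps), g (?Y ps), g (?Z ps)) = (g (?X qs), g (?Y qs), g (?Z qs))"
    then have "?X ps = ?X qs" "?Y ps = ?Y qs" using geq B by auto
    then show "ps = qs" by (metis zip_map_fst_snd)
  qed
  then have cT: "card T = card S" unfolding T_def by (rule card_image)
  have T: "T \<subseteq> {..<n} \<times> {..<n} \<times> {..<n}"
    unfolding T_def using B g(2) by (auto simp: image_subset_iff)
  have len: "length ps = D" if "ps \<in> S" for ps
    using that by (simp add: S_def triples_def)
  have \<delta>: "(\<Sum>i<D. (?X ps ! i - ?Y ps ! i)\<^sup>2) = r" if "ps \<in> S" for ps
  proof -
    have "r = ?\<delta> ps" using that by (simp add: S_def)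
    also have "\<dots> = (\<Sum>i<D. (?X ps ! i - ?Y ps ! i)\<^sup>2)"
      using len[OF that] by (simp add: sum_list_sum_nth atLeast0LessThan)
    finally show ?thesis by simp
  qed
  have uniq: "x' = x \<and> y' = y \<and> z' = z" if t: "(x, y, z') \<in> T" "(x, y', z) \<in> T" "(x', y, z) \<in> T"
    for x y z x' y' z'
  proof -
    obtain p where p: "p \<in> S" "x = g (?X p)" "y = g (?Y p)" "z' = g (?Z p)"
      using t(1) unfolding T_def by blast
    obtain q where q: "q \<in> S" "x = g (?X q)" "y' = g (?Y q)" "z = g (?Z q)"
      using t(2) unfolding T_def by blast
    obtain s where s: "s \<in> S" "x' = g (?X s)" "y = g (?Y s)" "z = g (?Z s)"
      using t(3) unfolding T_def by blast
    have eq: "?X q = ?X p" "?Y s = ?Y p" "?Z s = ?Z q"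
      using geq[OF _ B(1)[OF q(1)] B(1)[OF p(1)]] geq[OF _ B(2)[OF s(1)] B(2)[OF p(1)]]
        geq[OF _ B(3)[OF s(1)] B(3)[OF q(1)]] p(2,3) q(2,4) s(3,4) by metis+
    have Z: "?Z t ! i = ?X t ! i + ?Y t ! i" if "i < D" "t \<in> S" for i t
      using that(1) len[OF that(2)] by simp
    have zp: "?Z p ! i = ?X p ! i + ?Y p ! i" and zq: "?Z q ! i = ?X p ! i + ?Y q ! i"
      and zs: "?Z q ! i = ?X s ! i + ?Y p ! i" if "i < D" for i
      using Z[OF that p(1)] Z[OF that q(1)] Z[OF that s(1)] unfolding eq by simp_all
    have l: "length (?X p) = D" "length (?Y p) = D" "length (?Z q) = D" "length (?X s) = D"
      "length (?Y q) = D" "length (?Z p) = D"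
      by (simp_all only: length_map len p(1) q(1) s(1))
    have "?X s = ?X p \<and> ?Y q = ?Y p \<and> ?Z p = ?Z q"
      using \<delta>[OF p(1)] \<delta>[OF q(1)] \<delta>[OF s(1)] unfolding eq
      by (intro pseudo_triangle_trivial[where r = r, OF l zp zq zs])
    then show ?thesis using p q s by simp
  qed
  have "real (card T) / (3 * (real n)\<^sup>2) \<le> eta (3 * n)"
    by (rule eta_ge_of_triples[OF T uniq])
  moreover have "real (card ?P) / ((4 * real_of_int R + 1) * (3 * (real n)\<^sup>2))
      \<le> real (card T) / (3 * (real n)\<^sup>2)"
  proof -
    have "real (card ?P) / (4 * real_of_int R + 1) \<le> real (card S)"
      using S assms(2) by (simp add: field_simps)
    then have "real (card ?P) / (4 * real_of_int R + 1) / (3 * (real n)\<^sup>2) \<le> real (card S) / (3 * (real n)\<^sup>2)"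
      by (rule divide_right_mono) simp
    then show ?thesis using cT by simp
  qed
  ultimately show ?thesis by linarith
qed

lemma exp_6_ge: "exp (6 :: real) \<ge> 32"
proof -
  have "(2 :: real) ^ 6 \<le> exp 1 ^ 6" using exp_ge_add_one_self[of 1] by (intro power_mono) auto
  then show ?thesis by (simp flip: exp_of_nat_mult)
qed

text \<open>
  Triples are sorted into cells according to their three squared norms divided by \<open>W\<close> and rounded
  down to integers. The
  comparison with the weights of parameter \<open>2 * W\<close> shows that triples of total squared norm
  exceeding \<open>12 * m * W\<close> carry at most half of the total weight, so \<open>(12 * m + 1)\<^sup>3\<close> cells suffice.
\<close>

lemma card_triples_ge_gauss:
  fixes W :: nat
  assumes "W > 0" and ratio: "(\<Sum>p\<in>pair_box K. pair_weight (2 * real W) p)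
      \<le> 16 * (\<Sum>p\<in>pair_box K. pair_weight (real W) p)"
    and pos: "(\<Sum>p\<in>pair_box K. pair_weight (real W) p) > 0"
  obtains i j k :: nat where "i + j + k \<le> 12 * m"
    "real (card (triples m (int W * (int i + 1)) (int W * (int j + 1)) (int W * (int k + 1))))
       \<ge> exp (real (i + j + k)) * (\<Sum>p\<in>pair_box K. pair_weight (real W) p) ^ m
          / (2 * (12 * real m + 1) ^ 3)"
proof -
  let ?A = "pair_box K" and ?g = "\<Sum>p\<in>pair_box K. pair_weight (real W) p"
  let ?X = "\<lambda>ps :: (int \<times> int) list. \<Sum>p\<leftarrow>ps. (fst p)\<^sup>2"
  let ?Y = "\<lambda>ps :: (int \<times> int) list. \<Sum>p\<leftarrow>ps. (snd p)\<^sup>2"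
  let ?Z = "\<lambda>ps :: (int \<times> int) list. \<Sum>p\<leftarrow>ps. (fst p + snd p)\<^sup>2"
  define Q where "Q ps = ?X ps + ?Y ps + ?Z ps" for ps
  define S where "S = {ps. set ps \<subseteq> ?A \<and> length ps = m}"
  let ?w = "\<lambda>V ps. \<Prod>p\<leftarrow>ps. pair_weight V p"
  have nonneg: "?X ps \<ge> 0" "?Y ps \<ge> 0" "?Z ps \<ge> 0" for ps
    by (rule sum_list_nonneg; auto)+
  have w: "?w V ps = exp (- real_of_int (Q ps) / V)" for V ps
    unfolding Q_def
    by (induction ps)
       (auto simp: pair_weight_def case_prod_beta add_divide_distrib diff_divide_distrib simp flip: exp_add)
  have finS: "finite S" unfolding S_def using finite_pair_box by (rule finite_lists_length_eq)
  have total: "(\<Sum>ps\<in>S. ?w V ps) = (\<Sum>p\<in>?A. pair_weight V p) ^ m" for V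
    unfolding S_def by (rule sum_prod_list_power[OF finite_pair_box])
  define G where "G = {ps \<in> S. Q ps \<le> int (12 * m * W)}"
  \<comment> \<open>Chernoff bound: discarding triples of large norm loses at most half of the weight\<close>
  have good: "(\<Sum>ps\<in>G. ?w W ps) \<ge> ?g ^ m / 2"
  proof (cases "m = 0")
    case True
    then have "S = {[]}" by (auto simp: S_def)
    then have "G = {[]}" using True by (auto simp: G_def Q_def)
    then show ?thesis using True by simp
  next
    case False
    have "(\<Sum>ps\<in>S - G. ?w W ps) \<le> (\<Sum>ps\<in>S - G. exp (- 6 * real m) * ?w (2 * real W) ps)"
    proof (rule sum_mono)
      fix ps assume "ps \<in> S - G"
      then have "int (12 * m * W) \<le> Q ps" by (auto simp: G_def)
      then have "12 * real m * real W \<le> real_of_int (Q ps)"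
        by (metis (no_types, opaque_lifting) of_int_le_iff of_int_of_nat_eq of_nat_mult of_nat_numeral)
      then have "6 * real m \<le> real_of_int (Q ps) / (2 * real W)"
        using assms(1) by (simp add: field_simps)
      moreover have "real_of_int (Q ps) / real W = real_of_int (Q ps) / (2 * real W) + real_of_int (Q ps) / (2 * real W)"
        by simp
      ultimately have "- real_of_int (Q ps) / real W \<le> - 6 * real m + (- real_of_int (Q ps) / (2 * real W))"
        by simp
      then show "?w W ps \<le> exp (- 6 * real m) * ?w (2 * real W) ps"
        unfolding w exp_add[symmetric] by simp
    qed
    also have "\<dots> \<le> (\<Sum>ps\<in>S. exp (- 6 * real m) * ?w (2 * real W) ps)"
      by (rule sum_mono2[OF finS]) (auto simp: w)
    also have "\<dots> = exp (- 6 * real m) * (\<Sum>p\<in>?A. pair_weight (2 * real W) p) ^ m"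
      by (simp add: total flip: sum_distrib_left)
    also have "\<dots> \<le> exp (- 6 * real m) * (16 * ?g) ^ m"
      by (intro mult_left_mono power_mono ratio sum_nonneg) (auto simp: pair_weight_def)
    also have "\<dots> = (16 * exp (- 6)) ^ m * ?g ^ m"
      by (simp add: power_mult_distrib exp_of_nat2_mult[symmetric] mult.commute)
    also have "\<dots> \<le> (1 / 2) * ?g ^ m"
    proof (rule mult_right_mono)
      have h: "16 * exp (- 6 :: real) \<le> 1 / 2" using exp_6_ge by (simp add: exp_minus field_simps)
      have "(16 * exp (- 6 :: real)) ^ m \<le> (1 / 2) ^ m" using h by (intro power_mono) auto
      also have "\<dots> \<le> (1 / 2 :: real) ^ 1" using False by (intro power_decreasing) auto
      finally show "(16 * exp (- 6 :: real)) ^ m \<le> 1 / 2" by simp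
    qed (use pos in auto)
    finally have "(\<Sum>ps\<in>S - G. ?w W ps) \<le> ?g ^ m / 2" by simp
    moreover have "(\<Sum>ps\<in>S. ?w W ps) = (\<Sum>ps\<in>S - G. ?w W ps) + (\<Sum>ps\<in>G. ?w W ps)"
      by (rule sum.subset_diff[OF _ finS]) (auto simp: G_def)
    ultimately show ?thesis by (simp add: total)
  qed
  \<comment> \<open>within a cell \<open>(i, j, k)\<close> every weight is at most \<open>exp (- (i + j + k))\<close>\<close>
  define cell where "cell ps = (nat (?X ps div int W), nat (?Y ps div int W), nat (?Z ps div int W))" for ps
  let ?C = "{..12 * m} \<times> {..12 * m} \<times> {..12 * m}"
  have div_le: "int W * (a div int W) \<le> a" for a
    using mult_div_mod_eq[of "int W" a] pos_mod_sign[of "int W" a] assms(1) by linarith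
  have bound: "nat (?X ps div int W) + nat (?Y ps div int W) + nat (?Z ps div int W) \<le> 12 * m"
    if "ps \<in> G" for ps
  proof -
    have "int W * (?X ps div int W + ?Y ps div int W + ?Z ps div int W) \<le> ?X ps + ?Y ps + ?Z ps"
      unfolding distrib_left by (intro add_mono div_le)
    also have "\<dots> \<le> int W * int (12 * m)"
      using that by (simp add: G_def Q_def mult_ac)
    finally have "?X ps div int W + ?Y ps div int W + ?Z ps div int W \<le> int (12 * m)"
      using assms(1) by simp
    moreover have "?X ps div int W \<ge> 0" "?Y ps div int W \<ge> 0" "?Z ps div int W \<ge> 0"
      using nonneg[of ps] assms(1) by (auto simp: pos_imp_zdiv_nonneg_iff)
    ultimately show ?thesis by linarith
  qed
  have finG: "finite G" using finS by (simp add: G_def)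
  have "cell ` G \<subseteq> ?C" using bound by (fastforce simp: cell_def)
  then obtain y where y: "y \<in> ?C"
      "(\<Sum>ps\<in>G. ?w W ps) \<le> real (card ?C) * (\<Sum>ps | ps \<in> G \<and> cell ps = y. ?w W ps)"
    by (rule pigeonhole_sum[OF finG, rotated 2]) auto
  obtain i j k where ijk: "y = (i, j, k)" by (cases y)
  let ?T = "triples m (int W * (int i + 1)) (int W * (int j + 1)) (int W * (int k + 1))"
  let ?H = "{ps \<in> G. cell ps = y}"
  have cC: "real (card ?C) = (12 * real m + 1) ^ 3"
    by (simp add: card_cartesian_product power3_eq_cube algebra_simps)
  have gpos: "?g ^ m / 2 > 0" using pos by simp
  have "?H \<noteq> {}"
  proof
    assume "?H = {}"
    then have "(\<Sum>ps | ps \<in> G \<and> cell ps = y. ?w W ps) = 0" by (metis sum.empty)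
    then show False using y(2) good gpos by simp
  qed
  then obtain ps where "ps \<in> G" "cell ps = y" by blast
  then have le: "i + j + k \<le> 12 * m" using bound[of ps] ijk by (simp add: cell_def)
  have sub: "?H \<subseteq> ?T"
  proof
    fix ps assume ps: "ps \<in> ?H"
    have *: "a \<le> int W * (int b + 1)" if "nat (a div int W) = b" "a \<ge> 0" for a b
    proof -
      have "a div int W = int b" using that assms(1) by (auto simp: pos_imp_zdiv_nonneg_iff)
      then have "a = int W * int b + a mod int W" by (metis mult_div_mod_eq)
      moreover have "a mod int W < int W" using assms(1) by simp
      ultimately show ?thesis by (simp add: algebra_simps)
    qed
    have "length ps = m" using ps by (simp add: G_def S_def)
    moreover have "?X ps \<le> int W * (int i + 1)" "?Y ps \<le> int W * (int j + 1)" "?Z ps \<le> int W * (int k + 1)"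
      by (rule *[OF _ nonneg(1)] *[OF _ nonneg(2)] *[OF _ nonneg(3)]; use ps ijk in \<open>simp add: cell_def\<close>)+
    ultimately show "ps \<in> ?T" unfolding triples_def by simp
  qed
  have "(\<Sum>ps\<in>?H. ?w W ps) \<le> (\<Sum>ps\<in>?H. exp (- real (i + j + k)))"
  proof (rule sum_mono)
    fix ps assume ps: "ps \<in> ?H"
    have *: "real b \<le> real_of_int a / real W" if "nat (a div int W) = b" "a \<ge> 0" for a b
    proof -
      have "a div int W = int b" using that assms(1) by (auto simp: pos_imp_zdiv_nonneg_iff)
      then have "int W * int b \<le> a" using div_le[of a] by simp
      then have "real W * real b \<le> real_of_int a"
        by (metis of_int_le_iff of_int_mult of_int_of_nat_eq)
      then show ?thesis using assms(1) by (simp add: field_simps)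
    qed
    have "real i \<le> real_of_int (?X ps) / real W" "real j \<le> real_of_int (?Y ps) / real W"
      "real k \<le> real_of_int (?Z ps) / real W"
      by (rule *[OF _ nonneg(1)] *[OF _ nonneg(2)] *[OF _ nonneg(3)]; use ps ijk in \<open>simp add: cell_def\<close>)+
    then have "real (i + j + k) \<le> real_of_int (Q ps) / real W"
      unfolding Q_def by (simp add: add_divide_distrib)
    then show "?w W ps \<le> exp (- real (i + j + k))" unfolding w by simp
  qed
  also have "\<dots> = real (card ?H) * exp (- real (i + j + k))" by simp
  also have "\<dots> \<le> real (card ?T) * exp (- real (i + j + k))"
    using card_mono[OF finite_triples sub] by (intro mult_right_mono) auto
  finally have up: "(\<Sum>ps\<in>?H. ?w W ps) \<le> real (card ?T) * exp (- real (i + j + k))" .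
  have "?g ^ m / 2 \<le> (12 * real m + 1) ^ 3 * (\<Sum>ps\<in>?H. ?w W ps)"
    using good y(2) unfolding cC by linarith
  also have "\<dots> \<le> (12 * real m + 1) ^ 3 * (real (card ?T) * exp (- real (i + j + k)))"
    by (intro mult_left_mono up) auto
  finally have *: "?g ^ m / 2 \<le> (12 * real m + 1) ^ 3 * (real (card ?T) * exp (- real (i + j + k)))" .
  define e where "e = exp (real (i + j + k))"
  have e: "e > 0" "exp (- real (i + j + k)) = 1 / e"
    by (simp_all only: e_def exp_gt_zero exp_minus inverse_eq_divide)
  have "(12 * real m + 1) ^ 3 > 0" by (intro zero_less_power) simp
  then have "e * ?g ^ m / (2 * (12 * real m + 1) ^ 3) \<le> real (card ?T)"
    using *[unfolded e(2)] e(1) by (simp add: field_simps)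
  then have "exp (real (i + j + k)) * ?g ^ m / (2 * (12 * real m + 1) ^ 3) \<le> real (card ?T)"
    by (simp only: e_def)
  with le show ?thesis by (rule that)
qed

section \<open>Comparison of Gaussian sums in dimension two and one\<close>
text \<open>
  An upper bound for the one-dimensional Gaussian sum over the integers of width
  \<open>sqrt (2 * W / 3)\<close> with \<open>W = (100 * D)\<^sup>2\<close>. This \<open>W\<close> is large enough for all discretisation errors to be
  relative errors of order \<open>1 / D\<close>, which stay bounded when raised to the power \<open>D\<close>.
\<close>

definition line_mass_bound :: "nat \<Rightarrow> real" where
  "line_mass_bound D = 1 + 2 * (sqrt (2 * (100 * real D)\<^sup>2 / 3) * gauss_const)"

lemma line_mass_bound_bounds:
  assumes "D \<ge> 1"
  shows "line_mass_bound D \<ge> 1" "line_mass_bound D \<le> 500 * real D"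
proof -
  have s: "sqrt (2 * (100 * real D)\<^sup>2 / 3) \<le> 100 * real D"
    by (rule real_le_lsqrt) (auto simp: power2_eq_square)
  have "sqrt (2 * (100 * real D)\<^sup>2 / 3) * gauss_const \<le> 100 * real D * 2"
    using gauss_const_bounds by (intro mult_mono[OF s]) auto
  then show "line_mass_bound D \<le> 500 * real D" using assms unfolding line_mass_bound_def by simp
  show "line_mass_bound D \<ge> 1"
    using gauss_const_bounds unfolding line_mass_bound_def by (simp add: mult_nonneg_nonneg)
qed

text \<open>
  The factor \<open>sqrt 3 / 2\<close> is the quotient of the widths \<open>sqrt (W / 2)\<close> and \<open>sqrt (2 * W / 3)\<close> that occur
  when the quadratic form \<open>u\<^sup>2 + v\<^sup>2 + (u + v)\<^sup>2\<close> is diagonalised.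
\<close>

lemma pair_weight_sum_estimate:
  assumes "D \<ge> 1"
  obtains K where
    "(\<Sum>p\<in>pair_box K. pair_weight ((100 * real D)\<^sup>2) p)
        \<ge> sqrt 3 / 2 * (1 - 1 / (2 * real D)) * (line_mass_bound D)\<^sup>2"
    "(\<Sum>p\<in>pair_box K. pair_weight (2 * (100 * real D)\<^sup>2) p)
        \<le> 16 * (\<Sum>p\<in>pair_box K. pair_weight ((100 * real D)\<^sup>2) p)"
    "(\<Sum>p\<in>pair_box K. pair_weight ((100 * real D)\<^sup>2) p) > 0"
proof -
  define W where "W = (100 * real D)\<^sup>2"
  have W: "W > 0" using assms by (simp add: W_def)
  define \<omega> where "\<omega> = sqrt (2 * W / 3)"
  define \<nu> where "\<nu> = sqrt (W / 2)"
  define a where "a = \<omega> * gauss_const"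
  define b where "b = \<nu> * gauss_const"
  have pos: "\<omega> > 0" "\<nu> > 0" using W by (simp_all add: \<omega>_def \<nu>_def)
  have "\<forall>\<^sub>F K in sequentially. gsum \<omega> K \<ge> a - 2 \<and> gsum \<nu> K \<ge> b - 2"
    unfolding a_def b_def by (intro eventually_conj gsum_ge pos)
  then obtain K where K: "gsum \<omega> K \<ge> a - 2" "gsum \<nu> K \<ge> b - 2"
    by (metis (mono_tags, lifting) eventually_sequentially le_refl)
  have \<nu>60: "\<nu> \<ge> 60 * real D"
    unfolding \<nu>_def W_def by (rule real_le_rsqrt) (simp add: power2_eq_square)
  have \<nu>\<omega>: "\<nu> = sqrt 3 / 2 * \<omega>"
  proof -
    have "W / 2 = (3 / 4) * (2 * W / 3)" by simp
    then have "\<nu> = sqrt (3 / 4) * \<omega>" unfolding \<nu>_def \<omega>_def by (simp only: real_sqrt_mult)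
    then show ?thesis by (simp add: real_sqrt_divide)
  qed
  define \<kappa> :: real where "\<kappa> = sqrt 3 / 2"
  have \<kappa>: "4 / 5 \<le> \<kappa>" "\<kappa> \<le> 1"
  proof -
    have "8 / 5 \<le> sqrt 3" by (rule real_le_rsqrt) (simp add: power2_eq_square)
    then show "4 / 5 \<le> \<kappa>" by (simp add: \<kappa>_def)
    have "sqrt 3 \<le> 2" by (rule real_le_lsqrt) auto
    then show "\<kappa> \<le> 1" by (simp add: \<kappa>_def)
  qed
  have b: "b = \<kappa> * a" unfolding a_def b_def \<kappa>_def using \<nu>\<omega> by simp
  have b20: "b \<ge> 20 * real D"
  proof -
    have "60 * real D * (1 / 3) \<le> \<nu> * gauss_const"
      using \<nu>60 gauss_const_bounds pos by (intro mult_mono) auto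
    then show ?thesis by (simp add: b_def)
  qed
  have ab: "b \<le> a"
  proof -
    have "a \<ge> 0" using pos gauss_const_bounds by (simp add: a_def)
    then show ?thesis unfolding b using mult_right_mono[OF \<kappa>(2)] by simp
  qed
  have a20: "a \<ge> 20 * real D" "a \<ge> 20" "b \<ge> 20" using ab b20 assms by simp_all
  let ?g = "\<Sum>p\<in>pair_box K. pair_weight W p"
  have g: "?g \<ge> 4 * (a - 2) * (b - 2)"
  proof -
    have "4 * (a - 2) * (b - 2) \<le> 4 * gsum \<omega> K * gsum \<nu> K"
      using K a20 gsum_nonneg[of \<omega> K] by (intro mult_mono) auto
    also have "\<dots> \<le> ?g" unfolding \<omega>_def \<nu>_def by (rule sum_pair_weight_bounds(1)[OF W])
    finally show ?thesis .
  qed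
  have h: "line_mass_bound D = 1 + 2 * a"
    unfolding line_mass_bound_def a_def \<omega>_def W_def by simp
  have "sqrt 3 / 2 * (1 - 1 / (2 * real D)) * (line_mass_bound D)\<^sup>2 \<le> 4 * (a - 2) * (b - 2)"
  proof -
    define x where "x = 1 / (2 * real D)"
    have "x * a \<ge> x * (20 * real D)"
      using a20(1) by (intro mult_left_mono) (auto simp: x_def)
    also have "x * (20 * real D) = 10" using assms by (simp add: x_def)
    finally have "10 \<le> x * a" .
    then have "10 * a \<le> x * a * a" using a20(2) by (intro mult_right_mono) auto
    also have "x * a * a \<le> x * (a + 1 / 2) * (a + 1 / 2)"
      using a20(2) by (intro mult_mono) (auto simp: x_def)
    finally have "\<kappa> * (40 * a) \<le> \<kappa> * (x * (1 + 2 * a)\<^sup>2)"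
      using \<kappa>(1) by (intro mult_left_mono) (auto simp: power2_eq_square algebra_simps)
    moreover have "4 / 5 * a \<le> \<kappa> * a" using \<kappa>(1) a20(2) by (intro mult_right_mono) auto
    moreover have "4 * (a - 2) * (\<kappa> * a - 2) - \<kappa> * (1 - x) * (1 + 2 * a)\<^sup>2
        = \<kappa> * (x * (1 + 2 * a)\<^sup>2) - 8 * a - 12 * (\<kappa> * a) + 16 - \<kappa>"
      by (simp add: power2_eq_square algebra_simps)
    ultimately have "4 * (a - 2) * (\<kappa> * a - 2) - \<kappa> * (1 - x) * (1 + 2 * a)\<^sup>2 \<ge> 0"
      using \<kappa> a20(2) by linarith
    then show ?thesis unfolding h b x_def \<kappa>_def by simp
  qed
  with g have 1: "?g \<ge> sqrt 3 / 2 * (1 - 1 / (2 * real D)) * (line_mass_bound D)\<^sup>2" by linarith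
  have half: "a * b \<le> 4 * (a - 2) * (b - 2)"
  proof -
    have "(a / 2) * (b / 2) \<le> (a - 2) * (b - 2)" using a20 by (intro mult_mono) auto
    then have "a * b \<le> 4 * ((a - 2) * (b - 2))" by simp
    then show ?thesis by (simp only: mult.assoc)
  qed
  have "a * b > 0" using a20 by simp
  with half g have 3: "?g > 0" by linarith
  have 2: "(\<Sum>p\<in>pair_box K. pair_weight (2 * W) p) \<le> 16 * ?g"
  proof -
    have s: "sqrt (2 * (2 * W) / 3) = sqrt 2 * \<omega>" "sqrt (2 * W / 2) = sqrt 2 * \<nu>"
      unfolding \<omega>_def \<nu>_def real_sqrt_mult[symmetric] by simp_all
    have r2: "sqrt 2 \<le> 71 / 50" by (rule real_le_lsqrt) (auto simp: power2_eq_square)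
    have "gsum (sqrt 2 * \<omega>) K \<le> sqrt 2 * a" "gsum (sqrt 2 * \<nu>) K \<le> sqrt 2 * b"
      using gsum_le[of "sqrt 2 * \<omega>" K] gsum_le[of "sqrt 2 * \<nu>" K] pos
      by (simp_all add: a_def b_def)
    moreover have "sqrt 2 * a \<le> 71 / 50 * a" "sqrt 2 * b \<le> 71 / 50 * b"
      using r2 a20 by (intro mult_right_mono; simp)+
    ultimately have e: "1 + 2 * gsum (sqrt 2 * \<omega>) K \<le> 3 * a" "2 + 2 * gsum (sqrt 2 * \<nu>) K \<le> 3 * b"
      using a20 by linarith+
    have "(\<Sum>p\<in>pair_box K. pair_weight (2 * W) p)
        \<le> (1 + 2 * gsum (sqrt 2 * \<omega>) K) * (2 + 2 * gsum (sqrt 2 * \<nu>) K)"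
      using sum_pair_weight_bounds(2)[of "2 * W" K] W unfolding s by simp
    also have "\<dots> \<le> (3 * a) * (3 * b)"
      using e gsum_nonneg[of "sqrt 2 * \<nu>" K] a20 by (intro mult_mono) auto
    also have "\<dots> \<le> 16 * (a * b)" using \<open>a * b > 0\<close> by simp
    also have "\<dots> \<le> 16 * ?g" using half g by linarith
    finally show ?thesis .
  qed
  show ?thesis using that[of K] 1 2 3 unfolding W_def by blast
qed

text \<open>
  Apart from powers of \<open>D\<close> this is the proportion \<open>(3/4)\<^sup>D\<^sup>/\<^sup>2\<close> of pairs: the
  remaining factor on the left is the square of \<open>exp (3 / 2 * \<sigma>) * line_mass_bound D ^ D\<close>, which
  up to a constant factor bounds the size of the ball of squared radius \<open>R\<close>.
\<close>

lemma many_triples: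
  assumes "D \<ge> 1"
  obtains \<sigma> :: nat where "\<sigma> \<le> 4 * D"
    "let R = int ((100 * D)\<^sup>2 * (\<sigma> + 5)) in
       exp (3 * real \<sigma>) * (sqrt 3 / 2) ^ D * line_mass_bound D ^ (2 * D)
         \<le> 160000 * (5 * real D) ^ 9 * real (card (triples D R R R))"
proof -
  define m where "m = D div 3"
  define r where "r = D mod 3"
  have D: "D = 3 * m + r" "r \<le> 2" unfolding m_def r_def by auto
  define w where "w = 100 * D"
  define h where "h = line_mass_bound D"
  define \<kappa> :: real where "\<kappa> = sqrt 3 / 2"
  have \<kappa>: "0 < \<kappa>" "\<kappa> \<le> 1"
  proof -
    have "sqrt 3 \<le> 2" by (rule real_le_lsqrt) auto
    then show "\<kappa> \<le> 1" by (simp add: \<kappa>_def)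
  qed (simp add: \<kappa>_def)
  have Ww: "real (w\<^sup>2) = (100 * real D)\<^sup>2" by (simp add: w_def)
  have h: "h \<ge> 1" "h \<le> 500 * real D" using line_mass_bound_bounds[OF assms] by (simp_all add: h_def)
  obtain K where K:
    "(\<Sum>p\<in>pair_box K. pair_weight (real (w\<^sup>2)) p) \<ge> \<kappa> * (1 - 1 / (2 * real D)) * h\<^sup>2"
    "(\<Sum>p\<in>pair_box K. pair_weight (2 * real (w\<^sup>2)) p)
        \<le> 16 * (\<Sum>p\<in>pair_box K. pair_weight (real (w\<^sup>2)) p)"
    "(\<Sum>p\<in>pair_box K. pair_weight (real (w\<^sup>2)) p) > 0"
    using pair_weight_sum_estimate[OF assms] unfolding Ww h_def \<kappa>_def by metis
  define g where "g = (\<Sum>p\<in>pair_box K. pair_weight (real (w\<^sup>2)) p)"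
  have "w\<^sup>2 > 0" using assms by (simp add: w_def)
  then obtain i j k where ijk: "i + j + k \<le> 12 * m"
    "real (card (triples m (int (w\<^sup>2) * (int i + 1)) (int (w\<^sup>2) * (int j + 1)) (int (w\<^sup>2) * (int k + 1))))
       \<ge> exp (real (i + j + k)) * g ^ m / (2 * (12 * real m + 1) ^ 3)"
    using card_triples_ge_gauss[OF _ K(2,3), of m] unfolding g_def by metis
  define \<sigma> where "\<sigma> = i + j + k"
  define t where "t = card (triples m (int (w\<^sup>2) * (int i + 1)) (int (w\<^sup>2) * (int j + 1)) (int (w\<^sup>2) * (int k + 1)))"
  define S where "S = int (w\<^sup>2) * (int \<sigma> + 3)"
  define R where "R = int ((100 * D)\<^sup>2 * (\<sigma> + 5))"
  have t3: "t ^ 3 \<le> card (triples (3 * m) S S S)"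
  proof -
    have "S = int (w\<^sup>2) * (int i + 1) + int (w\<^sup>2) * (int j + 1) + int (w\<^sup>2) * (int k + 1)"
      by (simp add: S_def \<sigma>_def algebra_simps)
    then show ?thesis unfolding t_def by (simp only:) (rule card_triples_threefold; simp)
  qed
  let ?V = "int r * int w ^ 2"
  have "real (t ^ 3) * ((real w)\<^sup>2 / 4) ^ r \<le> real (card (triples (3 * m) S S S)) * real (card (triples r ?V ?V ?V))"
    using t3 by (intro mult_mono card_triples_power) auto
  also have "\<dots> \<le> real (card (triples (3 * m + r) (S + ?V) (S + ?V) (S + ?V)))"
    unfolding of_nat_mult[symmetric] of_nat_le_iff by (rule card_triples_append)
  also have "\<dots> \<le> real (card (triples D R R R))"
  proof -
    have "S + ?V = int w ^ 2 * (int \<sigma> + 3 + int r)" by (simp add: S_def algebra_simps)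
    also have "\<dots> \<le> int w ^ 2 * (int \<sigma> + 5)" using D(2) by (intro mult_left_mono) auto
    also have "\<dots> = R" by (simp add: R_def w_def)
    finally have "S + ?V \<le> R" .
    then have "triples D (S + ?V) (S + ?V) (S + ?V) \<subseteq> triples D R R R" by (intro triples_mono)
    then show ?thesis unfolding D(1)[symmetric] by (simp add: card_mono finite_triples)
  qed
  finally have P: "real t ^ 3 * ((real w)\<^sup>2 / 4) ^ r \<le> real (card (triples D R R R))" by simp
  have g: "g \<ge> \<kappa> * (1 - 1 / (2 * real D)) * h\<^sup>2" using K(1) by (simp add: g_def)
  have x: "0 \<le> 1 - 1 / (2 * real D)" "1 - 1 / (2 * real D) \<le> 1" using assms by (auto simp: field_simps)
  \<comment> \<open>by Bernoulli the error factor \<open>1 - 1 / (2 * D)\<close> costs at most one half in total\<close>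
  have "(1 / 2) * \<kappa> ^ D * h ^ (6 * m) \<le> g ^ (3 * m)"
  proof -
    have "1 / 2 = 1 + real D * (- 1 / (2 * real D))" using assms by (simp add: field_simps)
    also have "\<dots> \<le> (1 + (- 1 / (2 * real D))) ^ D"
      by (rule Bernoulli_inequality) (use assms in \<open>simp add: field_simps\<close>)
    also have "\<dots> \<le> (1 - 1 / (2 * real D)) ^ (3 * m)"
      using x D by (simp add: power_decreasing)
    finally have A: "1 / 2 \<le> (1 - 1 / (2 * real D)) ^ (3 * m)" .
    have "\<kappa> ^ D \<le> \<kappa> ^ (3 * m)" using \<kappa> D by (intro power_decreasing) auto
    then have "(1 / 2) * \<kappa> ^ D * h ^ (6 * m) \<le> (1 - 1 / (2 * real D)) ^ (3 * m) * \<kappa> ^ (3 * m) * h ^ (6 * m)"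
      using A \<kappa> h x by (intro mult_mono mult_right_mono) auto
    also have "\<dots> = (\<kappa> * (1 - 1 / (2 * real D)) * h\<^sup>2) ^ (3 * m)"
      by (simp add: power_mult_distrib power_mult[symmetric] mult_ac)
    also have "\<dots> \<le> g ^ (3 * m)" using g \<kappa> x by (intro power_mono) auto
    finally show ?thesis .
  qed
  \<comment> \<open>the \<open>r \<le> 2\<close> coordinates left over cost at most a factor 100 each\<close>
  moreover have "h ^ (2 * r) / 10000 \<le> ((real w)\<^sup>2 / 4) ^ r"
  proof -
    have "h\<^sup>2 \<le> (500 * real D)\<^sup>2" using h by (intro power_mono) auto
    then have "h\<^sup>2 / 100 \<le> (real w)\<^sup>2 / 4" by (simp add: w_def power2_eq_square)
    then have "(h\<^sup>2 / 100) ^ r \<le> ((real w)\<^sup>2 / 4) ^ r" by (intro power_mono) auto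
    moreover have "(100 :: real) ^ r \<le> 100 ^ 2" using D(2) by (intro power_increasing) auto
    then have "h ^ (2 * r) / 10000 \<le> h ^ (2 * r) / 100 ^ r"
      using h by (intro divide_left_mono) auto
    moreover have "h ^ (2 * r) / 100 ^ r = (h\<^sup>2 / 100) ^ r" by (simp add: power_divide power_mult)
    ultimately show ?thesis by linarith
  qed
  ultimately have "(1 / 2) * \<kappa> ^ D * h ^ (6 * m) * (h ^ (2 * r) / 10000) \<le> g ^ (3 * m) * ((real w)\<^sup>2 / 4) ^ r"
    using \<kappa> h K(3) by (intro mult_mono) (auto simp: g_def)
  moreover have "h ^ (6 * m) * h ^ (2 * r) = h ^ (2 * D)" unfolding D(1) by (simp flip: power_add)
  ultimately have gw: "\<kappa> ^ D * h ^ (2 * D) / 20000 \<le> g ^ (3 * m) * ((real w)\<^sup>2 / 4) ^ r"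
    by (simp add: mult_ac)
  have tl: "exp (3 * real \<sigma>) * g ^ (3 * m) \<le> 8 * (5 * real D) ^ 9 * real t ^ 3"
  proof -
    have m1: "12 * real m + 1 \<le> 5 * real D" using D assms by linarith
    have "exp (real \<sigma>) * g ^ m \<le> 2 * (12 * real m + 1) ^ 3 * real t"
      using ijk(2) unfolding t_def \<sigma>_def by (subst (asm) pos_divide_le_eq) (auto simp: mult_ac)
    also have "\<dots> \<le> 2 * (5 * real D) ^ 3 * real t"
      using m1 by (intro mult_right_mono mult_left_mono power_mono) auto
    finally have "(exp (real \<sigma>) * g ^ m) ^ 3 \<le> (2 * (5 * real D) ^ 3 * real t) ^ 3"
      using K(3) by (intro power_mono) (auto simp: g_def)
    moreover have "exp (real \<sigma>) ^ 3 = exp (3 * real \<sigma>)" by (simp flip: exp_of_nat_mult)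
    ultimately show ?thesis by (simp add: power_mult_distrib power_mult[symmetric] mult_ac)
  qed
  have "exp (3 * real \<sigma>) * (\<kappa> ^ D * h ^ (2 * D) / 20000) \<le> exp (3 * real \<sigma>) * (g ^ (3 * m) * ((real w)\<^sup>2 / 4) ^ r)"
    by (intro mult_left_mono gw) auto
  also have "\<dots> = exp (3 * real \<sigma>) * g ^ (3 * m) * ((real w)\<^sup>2 / 4) ^ r" by simp
  also have "\<dots> \<le> 8 * (5 * real D) ^ 9 * real t ^ 3 * ((real w)\<^sup>2 / 4) ^ r"
    by (intro mult_right_mono tl) auto
  also have "\<dots> = 8 * (5 * real D) ^ 9 * (real t ^ 3 * ((real w)\<^sup>2 / 4) ^ r)" by simp
  also have "\<dots> \<le> 8 * (5 * real D) ^ 9 * real (card (triples D R R R))"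
    by (intro mult_left_mono P) auto
  finally have "exp (3 * real \<sigma>) * \<kappa> ^ D * h ^ (2 * D) \<le> 160000 * (5 * real D) ^ 9 * real (card (triples D R R R))"
    by simp
  moreover have "\<sigma> \<le> 4 * D" using ijk(1) D by (simp add: \<sigma>_def)
  ultimately show ?thesis using that[of \<sigma>] unfolding R_def h_def \<kappa>_def Let_def by blast
qed

section \<open>The lower bound for a given dimension\<close>
text \<open>
  Since \<open>\<kappa> \<ge> D\<close>, passing from \<open>\<kappa>\<close> to \<open>\<kappa> + 1\<close> changes \<open>\<kappa> ^ D\<close> by a factor of at most
  \<open>(1 + 1 / D) ^ D \<le> 3\<close>, so the prescribed size \<open>n\<close> is attained up to a constant.
\<close>

lemma exists_dilation:
  fixes U :: real
  assumes "U > 0" "D \<ge> 1" "U * real D ^ D \<le> real n"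
  obtains \<kappa> :: nat where "\<kappa> \<ge> D" "U * real \<kappa> ^ D \<le> real n" "real n \<le> 3 * U * real \<kappa> ^ D"
proof -
  define q where "q = root D (real n / U)"
  have nU: "real n / U \<ge> 0" using assms(1) by simp
  have q: "q ^ D = real n / U" unfolding q_def using assms(2) nU by (intro real_root_pow_pos2) auto
  have "real D ^ D \<le> real n / U" using assms by (simp add: field_simps)
  then have "root D (real D ^ D) \<le> q" unfolding q_def using assms(2) by (intro real_root_le_mono) auto
  then have Dq: "real D \<le> q" using assms(2) by (simp add: real_root_power_cancel)
  define \<kappa> where "\<kappa> = nat \<lfloor>q\<rfloor>"
  have k: "real \<kappa> \<le> q" "q \<le> real \<kappa> + 1" "\<kappa> \<ge> D"
    using Dq unfolding \<kappa>_def by linarith+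
  have "real \<kappa> ^ D \<le> real n / U" unfolding q[symmetric] using k by (intro power_mono) auto
  then have 1: "U * real \<kappa> ^ D \<le> real n" using assms(1) by (simp add: field_simps)
  have "real n / U \<le> (real \<kappa> + 1) ^ D" unfolding q[symmetric] using k Dq by (intro power_mono) auto
  also have "\<dots> \<le> (real \<kappa> * (1 + 1 / real D)) ^ D"
  proof (rule power_mono)
    have "1 \<le> real \<kappa> / real D" using k(3) assms(2) by simp
    then show "real \<kappa> + 1 \<le> real \<kappa> * (1 + 1 / real D)" by (simp add: algebra_simps)
  qed simp
  also have "\<dots> = real \<kappa> ^ D * (1 + 1 / real D) ^ D" by (rule power_mult_distrib)
  also have "\<dots> \<le> real \<kappa> ^ D * 3"
  proof (rule mult_left_mono)
    have "(1 + 1 / real D) ^ D \<le> exp (1 / real D) ^ D"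
      by (intro power_mono) auto
    also have "\<dots> = exp 1" using assms(2) by (simp flip: exp_of_nat_mult)
    finally show "(1 + 1 / real D) ^ D \<le> 3" using exp_le by simp
  qed simp
  finally have "real n \<le> 3 * U * real \<kappa> ^ D" using assms(1) by (simp add: field_simps)
  with 1 k(3) show ?thesis by (intro that)
qed

text \<open>
  The hypothesis on \<open>n\<close> leaves room for a dilation of the basic configuration by at least \<open>D\<close>.
\<close>

lemma threshold_bound:
  assumes "D \<ge> 1" "\<sigma> \<le> 4 * D" "n > (2 * D) ^ (100 * D)"
  shows "exp (3 / 2 * (real \<sigma> + 15)) * line_mass_bound D ^ D * real D ^ D \<le> real n"
proof -
  have "exp (3 / 2 * (real \<sigma> + 15)) \<le> exp (29 * real D)"
    using assms by simp
  also have "\<dots> = (exp 1 ^ 29) ^ D" by (simp flip: exp_of_nat_mult add: mult.commute)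
  also have "\<dots> \<le> (3 ^ 29) ^ D" using exp_le by (intro power_mono) auto
  finally have e: "exp (3 / 2 * (real \<sigma> + 15)) \<le> (3 ^ 29) ^ D" .
  have "line_mass_bound D ^ D \<le> (500 * real D) ^ D"
    using line_mass_bound_bounds[OF assms(1)] by (intro power_mono) auto
  then have "exp (3 / 2 * (real \<sigma> + 15)) * line_mass_bound D ^ D * real D ^ D
      \<le> (3 ^ 29) ^ D * (500 * real D) ^ D * real D ^ D"
    using e line_mass_bound_bounds[OF assms(1)] by (intro mult_mono) auto
  also have "\<dots> = (3 ^ 29 * (500 * real D) * real D) ^ D"
    by (simp only: power_mult_distrib)
  also have "\<dots> \<le> ((2 * real D) ^ 100) ^ D"
  proof (rule power_mono)
    have "real D ^ 2 \<le> real D ^ 100" using assms(1) by (intro power_increasing) auto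
    then have "3 ^ 29 * 500 * real D ^ 2 \<le> 2 ^ 100 * real D ^ 100"
      by (intro mult_mono) auto
    then show "3 ^ 29 * (500 * real D) * real D \<le> (2 * real D) ^ 100"
      by (simp add: power_mult_distrib power2_eq_square)
  qed simp
  also have "\<dots> = real ((2 * D) ^ (100 * D))" by (simp add: power_mult)
  also have "\<dots> \<le> real n" using assms(3) by linarith
  finally show ?thesis .
qed

lemma eta_lower_bound:
  "\<exists>c > 0. \<forall>D n :: nat. D \<ge> 1 \<longrightarrow> n > (2 * D) ^ (100 * D) \<longrightarrow>
     eta (3 * n) \<ge> c * real D powr (- 12) * (3 / 4) powr (real D / 2) * real n powr (- 2 / real D)"
proof -
  \<comment> \<open>the constants lost in \<open>many_triples\<close>, in the choice of a distance, and in comparing \<open>n\<^sup>2\<close> with the ball\<close>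
  define c :: real where "c = 1 / (160000 * 5 ^ 9 * 950000 * 27 * exp 45)"
  have "eta (3 * n) \<ge> c * real D powr (- 12) * (3 / 4) powr (real D / 2) * real n powr (- 2 / real D)"
    if D: "D \<ge> 1" and n: "n > (2 * D) ^ (100 * D)" for D n :: nat
  proof -
    define h where "h = line_mass_bound D"
    have h: "h \<ge> 1" using line_mass_bound_bounds[OF D] by (simp add: h_def)
    define z :: real where "z = sqrt 3 / 2"
    have z: "z > 0" by (simp add: z_def)
    obtain \<sigma> :: nat where \<sigma>: "\<sigma> \<le> 4 * D"
      and trip: "let R = int ((100 * D)\<^sup>2 * (\<sigma> + 5)) in
       exp (3 * real \<sigma>) * z ^ D * h ^ (2 * D) \<le> 160000 * (5 * real D) ^ 9 * real (card (triples D R R R))"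
      using many_triples[OF D] unfolding h_def z_def by metis
    \<comment> \<open>squared radius of the basic configuration\<close>
    define R0 where "R0 = int ((100 * D)\<^sup>2 * (\<sigma> + 5))"
    \<comment> \<open>enlarged so that it absorbs the cubes attached to the points, up to the factor \<open>\<kappa>\<^sup>2\<close>\<close>
    define R1 where "R1 = int ((100 * D)\<^sup>2 * (\<sigma> + 15))"
    \<comment> \<open>the dilated ball of squared radius \<open>\<kappa>\<^sup>2 * R1\<close> has at most \<open>U * \<kappa> ^ D\<close> points\<close>
    define U where "U = exp (3 / 2 * (real \<sigma> + 15)) * h ^ D"
    have "1 * 1 \<le> exp (3 / 2 * (real \<sigma> + 15)) * h ^ D"
      using h by (intro mult_mono) (auto simp: one_le_power)
    then have U1: "U \<ge> 1" by (simp add: U_def)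
    obtain \<kappa> where \<kappa>: "\<kappa> \<ge> D" "U * real \<kappa> ^ D \<le> real n" "real n \<le> 3 * U * real \<kappa> ^ D"
      using exists_dilation[of U D n] U1 D threshold_bound[OF D \<sigma> n] unfolding U_def h_def by auto
    have \<kappa>1: "\<kappa> \<ge> 1" using \<kappa>(1) D by linarith
    define R where "R = int \<kappa> ^ 2 * R1"
    have "(int D + 1) * R0 + 4 * (int D)\<^sup>2 * (int D + 1) \<le> int D * R1"
    proof -
      have "int D * R1 - (int D + 1) * R0 = 10000 * (int D)\<^sup>2 * (10 * int D - int \<sigma> - 5)"
        unfolding R0_def R1_def by (simp add: power2_eq_square algebra_simps)
      also have "\<dots> \<ge> 10000 * (int D)\<^sup>2 * int D"
        using \<sigma> D by (intro mult_left_mono) auto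
      finally have "10000 * (int D)\<^sup>2 * int D \<le> int D * R1 - (int D + 1) * R0" .
      moreover have "4 * (int D)\<^sup>2 * (int D + 1) \<le> 4 * (int D)\<^sup>2 * (2 * int D)"
        using D by (intro mult_left_mono) auto
      moreover have "4 * (int D)\<^sup>2 * (2 * int D) \<le> 10000 * (int D)\<^sup>2 * int D" by simp
      ultimately show ?thesis by linarith
    qed
    then have "card (triples D R0 R0 R0) * (\<kappa>\<^sup>2) ^ D \<le> card (triples D R R R)"
      unfolding R_def using D \<kappa>1 by (intro card_triples_dilate) auto
    then have dil: "real (card (triples D R0 R0 R0)) * real \<kappa> ^ (2 * D) \<le> real (card (triples D R R R))"
      unfolding power_mult by (metis of_nat_le_iff of_nat_mult of_nat_power)
    define \<omega> where "\<omega> = real \<kappa> * sqrt (2 * (100 * real D)\<^sup>2 / 3)"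
    have \<omega>: "\<omega> > 0" "\<omega>\<^sup>2 = (real \<kappa>)\<^sup>2 * (2 * (100 * real D)\<^sup>2 / 3)"
      using \<kappa>1 D by (simp_all add: \<omega>_def power_mult_distrib)
    have ball: "card (lattice_ball D R) \<le> n"
    proof -
      have "real (card (lattice_ball D R)) \<le> exp (real_of_int R / \<omega>\<^sup>2) * (1 + 2 * \<omega> * gauss_const) ^ D"
        by (rule card_lattice_ball_le[OF \<omega>(1)])
      also have "real_of_int R / \<omega>\<^sup>2 = 3 / 2 * (real \<sigma> + 15)"
        unfolding \<omega>(2) R_def R1_def using \<kappa>1 D by (simp add: field_simps)
      also have "(1 + 2 * \<omega> * gauss_const) ^ D \<le> (real \<kappa> * h) ^ D"
      proof (rule power_mono)
        show "1 + 2 * \<omega> * gauss_const \<le> real \<kappa> * h"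
          using \<kappa>1 unfolding h_def line_mass_bound_def \<omega>_def by (simp add: algebra_simps)
      qed (use \<omega> gauss_const_bounds in auto)
      finally have "real (card (lattice_ball D R)) \<le> U * real \<kappa> ^ D"
        by (simp add: U_def power_mult_distrib mult_ac)
      then show ?thesis using \<kappa>(2) by linarith
    qed
    have R_nonneg: "R \<ge> 0" by (simp add: R_def R1_def)
    define P where "P = real (card (triples D R0 R0 R0))"
    define A where "A = exp (3 * real \<sigma>) * h ^ (2 * D)"
    define M where "M = 160000 * (5 * real D) ^ 9"
    define B where "B = 950000 * (real \<kappa>)\<^sup>2 * real D ^ 3 * (27 * exp 45 * A * real \<kappa> ^ (2 * D))"
    have pos: "A > 0" "M > 0" "B > 0" using h D \<kappa>1 by (simp_all add: A_def M_def B_def)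
    have PM: "A * z ^ D / M \<le> P"
      using trip pos(2) unfolding Let_def R0_def[symmetric] P_def A_def M_def by (simp add: field_simps)
    have n0: "real n > 0" using n by (metis gr_implies_not0 of_nat_0_less_iff neq0_conv)
    have den: "(4 * real_of_int R + 1) * (3 * (real n)\<^sup>2) \<le> B"
    proof -
      have "real_of_int R1 = 10000 * (real D)\<^sup>2 * (real \<sigma> + 15)" by (simp add: R1_def power_mult_distrib)
      also have "\<dots> \<le> 10000 * (real D)\<^sup>2 * (19 * real D)"
        using \<sigma> D by (intro mult_left_mono) auto
      finally have "real_of_int R1 \<le> 190000 * real D ^ 3" by (simp add: power2_eq_square power3_eq_cube)
      then have "(real \<kappa>)\<^sup>2 * real_of_int R1 \<le> (real \<kappa>)\<^sup>2 * (190000 * real D ^ 3)"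
        by (intro mult_left_mono) auto
      then have "real_of_int R \<le> 190000 * (real \<kappa>)\<^sup>2 * real D ^ 3" by (simp add: R_def)
      moreover have "1 * 1 \<le> (real \<kappa>)\<^sup>2 * real D ^ 3"
        using \<kappa>1 D by (intro mult_mono) (auto simp: one_le_power)
      ultimately have 1: "4 * real_of_int R + 1 \<le> 950000 * (real \<kappa>)\<^sup>2 * real D ^ 3" by linarith
      have "(real n)\<^sup>2 \<le> (3 * U * real \<kappa> ^ D)\<^sup>2" using \<kappa>(3) by (intro power_mono) auto
      also have "\<dots> = 9 * (exp 45 * A * real \<kappa> ^ (2 * D))"
      proof -
        have "exp (3 / 2 * (real \<sigma> + 15)) ^ 2 = exp 45 * exp (3 * real \<sigma>)"
          by (simp flip: exp_of_nat_mult exp_add add: algebra_simps)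
        then show ?thesis
          by (simp add: U_def A_def power_mult_distrib power_mult[symmetric] mult_ac)
      qed
      finally have 2: "3 * (real n)\<^sup>2 \<le> 27 * exp 45 * A * real \<kappa> ^ (2 * D)" by (simp add: mult_ac)
      show ?thesis unfolding B_def by (rule mult_mono[OF 1 2]) auto
    qed
    \<comment> \<open>the factors \<open>exp (3 * \<sigma>) * h ^ (2 * D) * \<kappa> ^ (2 * D)\<close> cancel\<close>
    have "c * real D powr (- 12) * z ^ D / (real \<kappa>)\<^sup>2 = A * z ^ D / M * real \<kappa> ^ (2 * D) / B"
    proof -
      have "real D powr (- 12) = 1 / real D ^ 12"
        using D by (simp add: powr_minus_divide powr_numeral)
      then show ?thesis
        using pos(1) D \<kappa>1 unfolding c_def M_def B_def
        by (simp add: power_mult_distrib field_simps flip: power_add)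
    qed
    also have "\<dots> \<le> P * real \<kappa> ^ (2 * D) / B"
      using PM pos by (intro divide_right_mono mult_right_mono) auto
    also have "\<dots> \<le> real (card (triples D R R R)) / B"
      using dil pos unfolding P_def by (intro divide_right_mono) auto
    also have "\<dots> \<le> real (card (triples D R R R)) / ((4 * real_of_int R + 1) * (3 * (real n)\<^sup>2))"
      using den R_nonneg n0 pos(3) by (intro divide_left_mono) (auto intro!: mult_pos_pos add_nonneg_pos)
    also have "\<dots> \<le> eta (3 * n)" by (rule eta_ge_of_ball[OF ball R_nonneg])
    finally have main: "c * real D powr (- 12) * z ^ D / (real \<kappa>)\<^sup>2 \<le> eta (3 * n)" .
    have "z ^ D = (3 / 4) powr (real D / 2)"
    proof -
      have "z = sqrt (3 / 4)" by (simp add: z_def real_sqrt_divide)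
      also have "\<dots> = (3 / 4) powr (1 / 2)" by (simp add: powr_half_sqrt)
      finally have "z ^ D = ((3 / 4) powr (1 / 2)) powr real D" by (simp only: powr_realpow powr_gt_zero)
      also have "\<dots> = (3 / 4) powr (real D / 2)" by (simp add: powr_powr)
      finally show ?thesis .
    qed
    moreover have "real n powr (- 2 / real D) \<le> 1 / (real \<kappa>)\<^sup>2"
    proof -
      have "real \<kappa> ^ D \<le> U * real \<kappa> ^ D" using U1 by (intro mult_le_cancel_right1[THEN iffD2]) auto
      then have "real \<kappa> ^ D \<le> real n" using \<kappa>(2) by linarith
      then have "(real \<kappa> ^ D) powr (2 / real D) \<le> real n powr (2 / real D)"
        by (intro powr_mono2) auto
      also have "(real \<kappa> ^ D) powr (2 / real D) = (real \<kappa>)\<^sup>2"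
      proof -
        have "real \<kappa> ^ D = real \<kappa> powr real D" using \<kappa>1 by (simp add: powr_realpow)
        then have "(real \<kappa> ^ D) powr (2 / real D) = real \<kappa> powr (real D * (2 / real D))"
          by (simp only: powr_powr)
        also have "real D * (2 / real D) = 2" using D by simp
        finally show ?thesis using \<kappa>1 by simp
      qed
      finally have "(real \<kappa>)\<^sup>2 \<le> real n powr (2 / real D)" .
      then have "1 / real n powr (2 / real D) \<le> 1 / (real \<kappa>)\<^sup>2"
        using \<kappa>1 n0 by (intro divide_left_mono) auto
      then show ?thesis by (simp add: powr_minus_divide)
    qed
    then have "c * real D powr (- 12) * z ^ D * real n powr (- 2 / real D)
        \<le> c * real D powr (- 12) * z ^ D * (1 / (real \<kappa>)\<^sup>2)"
      using z by (intro mult_left_mono) (auto simp: c_def)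
    ultimately show ?thesis using main by simp
  qed
  moreover have "c > 0" by (simp add: c_def)
  ultimately show ?thesis by blast
qed

section \<open>Optimising the dimension\<close>
lemma powr_3_4: "(3 / 4 :: real) powr x = 2 powr (- log 2 (4 / 3) * x)"
proof -
  have "(3 / 4 :: real) = 2 powr (- log 2 (4 / 3))"
    by (simp add: powr_minus_divide)
  then show ?thesis by (metis powr_powr)
qed

text \<open>
  With \<open>x = log 2 N\<close> this makes \<open>(2 * D) ^ (100 * D)\<close> smaller than \<open>N / 4\<close> for
  \<open>1 \<le> D \<le> 2 * sqrt (x / a) + 1\<close>.
\<close>

lemma eventually_dimension_admissible:
  fixes a :: real
  assumes "a > 0"
  shows "\<forall>\<^sub>F x in at_top. 100 * (2 * sqrt (x / a) + 1) * log 2 (2 * (2 * sqrt (x / a) + 1)) < x - 2"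
  using assms by real_asymp

lemma error_term_tendsto_0:
  fixes a :: real
  assumes "a > 0"
  shows "((\<lambda>x. (a / 2 + 12 * log 2 (2 * sqrt (x / a) + 1)) / sqrt x) \<longlongrightarrow> 0) at_top"
  using assms by real_asymp

text \<open>
  With \<open>a = log 2 (4 / 3)\<close> and \<open>L = log 2 N\<close> the loss in dimension \<open>D\<close> is \<open>2\<close> to the power
  \<open>a * D / 2 + 2 * L / D + O (log D)\<close>, and \<open>D = 2 * sqrt (L / a)\<close>, rounded up, balances the first two terms.
\<close>

lemma eta_asymptotic_lower_bound:
  "\<exists>(c' :: real) (\<theta> :: nat \<Rightarrow> real). c' > 0 \<and> \<theta> \<longlonglongrightarrow> 0 \<and>
      (\<forall>\<^sub>F n in sequentially.
         eta n \<ge> c' * 2 powr (- (2 * sqrt (log 2 (4 / 3)) + \<theta> n) * sqrt (log 2 (real n))))"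
proof -
  obtain c where c: "c > 0" and low: "\<And>D n :: nat. D \<ge> 1 \<Longrightarrow> n > (2 * D) ^ (100 * D) \<Longrightarrow>
     eta (3 * n) \<ge> c * real D powr (- 12) * (3 / 4) powr (real D / 2) * real n powr (- 2 / real D)"
    using eta_lower_bound by blast
  define a :: real where "a = log 2 (4 / 3)"
  have a: "a > 0" by (simp add: a_def)
  define s where "s x = 2 * sqrt (x / a)" for x
  define \<theta> where "\<theta> N = (a / 2 + 12 * log 2 (s (log 2 (real N)) + 1)) / sqrt (log 2 (real N))" for N :: nat
  have log_lim: "filterlim (\<lambda>N :: nat. log 2 (real N)) at_top sequentially" by real_asymp
  have "\<theta> \<longlonglongrightarrow> 0"
    unfolding \<theta>_def s_def by (rule filterlim_compose[OF error_term_tendsto_0[OF a] log_lim])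
  moreover have "\<forall>\<^sub>F N in sequentially.
      eta N \<ge> c / 4 * 2 powr (- (2 * sqrt a + \<theta> N) * sqrt (log 2 (real N)))"
    using eventually_compose_filterlim[OF eventually_dimension_admissible[OF a] log_lim]
      eventually_ge_at_top[of 8]
  proof eventually_elim
    case (elim N)
    define L where "L = log 2 (real N)"
    define n where "n = N div 3"
    define D where "D = nat \<lceil>s L\<rceil>"
    have L: "L > 0" using elim(2) by (simp add: L_def)
    have s: "s L > 0" using L a by (simp add: s_def)
    have D: "D \<ge> 1" "s L \<le> real D" "real D \<le> s L + 1"
      using s unfolding D_def by linarith+
    have D1: "1 \<le> real D" using D(1) by simp
    have n: "n \<ge> 1" "real N \<le> 4 * real n" "2 * (3 * n) \<ge> N" "3 * n \<le> N" "n \<le> N"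
      using elim(2) unfolding n_def by linarith+
    have N: "real N = 2 powr L" using elim(2) by (simp add: L_def)
    have large: "n > (2 * D) ^ (100 * D)"
    proof -
      have D2: "2 * real D = 2 powr (log 2 (2 * real D))" using D(1) by simp
      have "real ((2 * D) ^ (100 * D)) = (2 * real D) powr (100 * real D)"
        using D(1) powr_realpow[of "2 * real D" "100 * D"] by simp
      also have "\<dots> = 2 powr (100 * real D * log 2 (2 * real D))"
        by (subst D2) (simp only: powr_powr mult.commute)
      also have "\<dots> \<le> 2 powr (100 * (s L + 1) * log 2 (2 * (s L + 1)))"
      proof -
        have "0 \<le> log 2 (2 * real D)"
          by (subst zero_le_log_cancel_iff) (use D1 in linarith)+
        then have "100 * real D * log 2 (2 * real D) \<le> 100 * (s L + 1) * log 2 (2 * (s L + 1))"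
          using D(3) D1 s by (intro mult_mono log_mono) simp_all
        then show ?thesis by simp
      qed
      also have "\<dots> < 2 powr (L - 2)"
        using elim(1) unfolding s_def L_def by simp
      also have "\<dots> = real N / 4" by (simp add: powr_diff N)
      also have "\<dots> \<le> real n" using n(2) by simp
      finally show ?thesis by (simp only: of_nat_less_iff)
    qed
    have sL: "s L * sqrt (a * L) = 2 * L" "a * s L = 2 * sqrt (a * L)"
      using a L by (simp_all add: s_def real_sqrt_mult real_sqrt_divide field_simps)
    have e1: "real D powr (- 12) \<ge> 2 powr (- (12 * log 2 (s L + 1)))"
    proof -
      have "2 powr (- (12 * log 2 (s L + 1))) = (2 powr log 2 (s L + 1)) powr (- 12)"
        by (simp add: powr_powr mult.commute)
      also have "\<dots> = (s L + 1) powr (- 12)" using s by simp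
      also have "\<dots> \<le> real D powr (- 12)" using D by (intro powr_mono2') auto
      finally show ?thesis .
    qed
    have e2: "(3 / 4) powr (real D / 2) \<ge> 2 powr (- (sqrt (a * L) + a / 2))"
    proof -
      have "a * real D \<le> a * (s L + 1)" using D a by (intro mult_left_mono) auto
      then have "a * (real D / 2) \<le> sqrt (a * L) + a / 2" using sL(2) by (simp add: algebra_simps)
      then show ?thesis unfolding powr_3_4 a_def[symmetric] by simp
    qed
    have e3: "real n powr (- 2 / real D) \<ge> 2 powr (- sqrt (a * L))"
    proof -
      have "2 * L / real D \<le> sqrt (a * L)"
      proof -
        have "2 * L \<le> real D * sqrt (a * L)" unfolding sL(1)[symmetric]
          using D a L by (intro mult_right_mono) auto
        then show ?thesis using D(1) by (simp add: field_simps)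
      qed
      then have "2 powr (- sqrt (a * L)) \<le> 2 powr (L * (- 2 / real D))" by (simp add: mult.commute)
      also have "\<dots> = real N powr (- 2 / real D)" by (simp add: N powr_powr)
      also have "\<dots> \<le> real n powr (- 2 / real D)" using n D by (intro powr_mono2') auto
      finally show ?thesis .
    qed
    have "- (2 * sqrt a + \<theta> N) * sqrt L
        = - (12 * log 2 (s L + 1)) + - (sqrt (a * L) + a / 2) + - sqrt (a * L)"
      using L unfolding \<theta>_def L_def[symmetric] by (simp add: real_sqrt_mult field_simps)
    then have "c * 2 powr (- (2 * sqrt a + \<theta> N) * sqrt L)
        = c * 2 powr (- (12 * log 2 (s L + 1))) * 2 powr (- (sqrt (a * L) + a / 2)) * 2 powr (- sqrt (a * L))"
      by (simp only: powr_add mult.assoc)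
    also have "\<dots> \<le> c * real D powr (- 12) * (3 / 4) powr (real D / 2) * real n powr (- 2 / real D)"
      using e1 e2 e3 c by (intro mult_mono) auto
    also have "\<dots> \<le> eta (3 * n)" by (rule low[OF D(1) large])
    finally have lower: "c * 2 powr (- (2 * sqrt a + \<theta> N) * sqrt L) \<le> eta (3 * n)" .
    have nonneg: "eta (3 * n) \<ge> 0" using lower c by (smt (verit) mult_pos_pos powr_gt_zero)
    have "eta (3 * n) * ((real N)\<^sup>2 / 4) \<le> eta (3 * n) * (real (3 * n))\<^sup>2"
    proof (rule mult_left_mono[OF _ nonneg])
      have "(real N / 2)\<^sup>2 \<le> (real (3 * n))\<^sup>2" using n(3) by (intro power_mono) auto
      then show "(real N)\<^sup>2 / 4 \<le> (real (3 * n))\<^sup>2" by (simp add: power_divide)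
    qed
    also have "\<dots> \<le> eta N * (real N)\<^sup>2" by (rule eta_mono[OF n(4)])
    finally have "eta (3 * n) / 4 \<le> eta N" using elim(2) by simp
    then show ?case using lower unfolding L_def by simp
  qed
  ultimately show ?thesis using c unfolding a_def
    by (intro exI[of _ "c / 4"] exI[of _ \<theta>]) auto
qed

theorem theorem1:
  "(\<exists>c C :: real. c > 0 \<and> C > 0 \<and>
      (\<forall>D n :: nat. D \<ge> 1 \<longrightarrow> n > (2 * D) ^ (100 * D) \<longrightarrow>
         eta (3 * n) \<ge> c * real D powr (- C) * (3 / 4) powr (real D / 2)
                         * real n powr (- 2 / real D)))
   \<and>
   (\<exists>(c' :: real) (\<theta> :: nat \<Rightarrow> real). c' > 0 \<and> \<theta> \<longlonglongrightarrow> 0 \<and>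
      (\<forall>\<^sub>F n in sequentially.
         eta n \<ge> c' * 2 powr (- (2 * sqrt (log 2 (4 / 3)) + \<theta> n) * sqrt (log 2 (real n)))))"
proof
  obtain c where "c > 0" "\<forall>D n :: nat. D \<ge> 1 \<longrightarrow> n > (2 * D) ^ (100 * D) \<longrightarrow>
     eta (3 * n) \<ge> c * real D powr (- 12) * (3 / 4) powr (real D / 2) * real n powr (- 2 / real D)"
    using eta_lower_bound by blast
  then show "\<exists>c C :: real. c > 0 \<and> C > 0 \<and>
      (\<forall>D n :: nat. D \<ge> 1 \<longrightarrow> n > (2 * D) ^ (100 * D) \<longrightarrow>
         eta (3 * n) \<ge> c * real D powr (- C) * (3 / 4) powr (real D / 2)
                         * real n powr (- 2 / real D))"
    by (intro exI[of _ c] exI[of _ 12]) simp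
qed (rule eta_asymptotic_lower_bound)

end
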